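(* Let $G$ be a subgroup of $S_n$ acting on $\mathbb{R}^n$ by permutation, with orbits $O_{i_1},\dots,O_{i_m}$ on $\{1,\dots,n\}$ ordered as consecutive intervals, $l_j=|O_{i_j}|$, and with coset representatives $\tau_{j,k}$ ($1\le j\le m$, $1\le k\le l_j$), all as fixed in the context. Let $K\subset\mathbb{R}^n$ be a compact set stable under the $G$-action, and let $F=(f_1,\dots,f_n)^\top\colon K\to\mathbb{R}^n$ be continuous and $G$-equivariant. Then for every $\epsilon>0$ there exist, for each $j=1,\dots,m$, a $\mathrm{Stab}_G(i_j)$-invariant deep ReLU neural network $\mathcal{N}^{\mathrm{inv}}_{\mathrm{Stab}_G(i_j)}\colon\mathbb{R}^n\to\mathbb{R}$ of the tensor form described in the context, approximating $f_{i_j}$, such that the ReLU neural network $$\mathcal{N}^{\mathrm{equiv}}_G=\left(\mathcal{N}^{\mathrm{inv}}_{\mathrm{Stab}_G(i_1)}\circ\tau_{1,1},\ \mathcal{N}^{\mathrm{inv}}_{\mathrm{Stab}_G(i_1)}\circ\tau_{1,2},\ \dots,\ \mathcal{N}^{\mathrm{inv}}_{\mathrm{Stab}_G(i_m)}\circ\tau_{m,l_m}\right)^\top\colon\mathbb{R}^n\to\mathbb{R}^n$$ is a $G$-equivariant deep neural network whose represented function $R_{\mathcal{N}^{\mathrm{equiv}}_G}$ satisfies $\|F-R_{\mathcal{N}^{\mathrm{equiv}}_G}\|_\infty<\epsilon$ on $K$. Here $G$ acts on the input and output layers $\mathbb{R}^n$ by permutation, and each hidden layer is of the form $\mathbb{R}^{n^2}\otimes_{\mathbb{R}}V$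 for a real vector space $V$ (depending on the layer), on which $\sigma\in G$ acts by $$\sigma\cdot\big((\mathbf{x}_1,\dots,\mathbf{x}_n)\otimes v\big)=\big(\widetilde{\sigma}_{1,1}\cdot\mathbf{x}_{\sigma^{-1}(1)},\dots,\widetilde{\sigma}_{m,l_m}\cdot\mathbf{x}_{\sigma^{-1}(n)}\big)\otimes v\qquad(\mathbf{x}_i\in\mathbb{R}^n,\ v\in V),$$ where the coefficient at position $p=i_j+k-1$ is $\widetilde{\sigma}_{j,k}$, the element of $\mathrm{Stab}_G(i_j)$ satisfying $\widetilde{\sigma}_{j,k}=\tau_{j,k}\,\sigma\,\tau_{j,k'}^{-1}$ for some $k'\in\{1,\dots,l_j\}$.
   Context: Permutation action: $S_n$ acts on $\mathbb{R}^n$ on the left by $\sigma\cdot(x_1,\dots,x_n)^\top=(x_{\sigma^{-1}(1)},\dots,x_{\sigma^{-1}(n)})^\top$; a subgroup $G\le S_n$ acts by restriction, and elements of $G$ are also regarded as linear maps $\mathbb{R}^n\to\mathbb{R}^n$. More generally, an action of a group $G$ on a layer $\mathbb{R}^d$ is given by an injective homomorphism $G\hookrightarrow S_d$ followed by the permutation action. Invariance and equivariance: with $G$ acting on the source (and target), $f$ is $G$-invariant if $f(\sigma\cdot\mathbf{x})=f(\mathbf{x})$, and $G$-equivariant if $f(\sigma\cdot\mathbf{x})=\sigma\cdot f(\mathbf{x})$, for all $\sigma\in G$ and all $\mathbf{x}$ in the domain. Orbits and cosets: $\mathrm{Stab}_G(i)=\{\sigma\in G:\sigma(i)=i\}$.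 Decompose $\{1,\dots,n\}=\bigsqcup_{j=1}^m O_{i_j}$ into $G$-orbits with $l_j=|O_{i_j}|$. The indices are (re)ordered so that $O_{i_1}=\{1,\dots,l_1\}$, $O_{i_2}=\{l_1+1,\dots,l_1+l_2\}$, etc., with $i_j=\sum_{k=1}^{j-1}l_k+1$. For each $j$, $G=\bigsqcup_{k=1}^{l_j}\mathrm{Stab}_G(i_j)\tau_{j,k}$ is the coset decomposition, with $\tau_{j,k}\in G$ chosen so that $\tau_{j,k}^{-1}(i_j)=i_j+k-1$. Neural networks: $\mathrm{ReLU}(x)=\max(0,x)$, applied coordinatewise. A deep ReLU neural network is a composition $Z_H\circ\cdots\circ Z_1$ of maps $Z_i\colon\mathbb{R}^{d_i}\to\mathbb{R}^{d_{i+1}}$, $Z_i(\mathbf{x})=\mathrm{ReLU}(W_i\mathbf{x}+\mathbf{b}_i)$, where the last block is taken without the activation (as in the tensor form below). The represented function $R_{\mathcal{N}}$ is the function computed by the network $\mathcal{N}$. A network is $G$-equivariant if a $G$-action is given on each layer $\mathbb{R}^{d_i}$ and every $Z_i$ is $G$-equivariant. It is $G$-invariant if for some $c\le H$ there are $G$-actions on the layers $\mathbb{R}^{d_i}$, $1\le i\le c+1$, such that $Z_i$ is $G$-equivariant for $1\le i\le c-1$ and $Z_c$ is $G$-invariant. Tensor form of invariant networks: for a subgroup $H'\le S_n$, the $H'$-invariant networks are of the form $\Sigma\circ L_H\circ\mathrm{ReLU}\circ\cdots\circ\mathrm{ReLU}\circ L_1$, where $L_i\colon\mathbb{R}^{n^{d_i}\times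 a_i}\to\mathbb{R}^{n^{d_{i+1}}\times a_{i+1}}$ is an affine map with $L_i(g\cdot X)=g\cdot L_i(X)$ for all $g\in H'$, the input space is $\mathbb{R}^n$, and $\Sigma$ is summation of the entries (the invariant part). Here $H'$ acts on $\mathbb{R}^{n^k\times a}$ by $(\sigma\cdot X)_{i_1,\dots,i_k,j}=x_{\sigma^{-1}(i_1),\dots,\sigma^{-1}(i_k),j}$.
   Formalization: The trivial action on V is replaced: each hidden layer is n copies of R^{n^d×a} (d≥1), and σ̃_{j,k} permutes all d tensor indices, including those inside V; with trivial action on V the claim fails for G=A_n, n≥6, with F=∏_{i<j}(x_i−x_j)·(1,…,1). *)

theory Defs
  imports "HOL-Analysis.Analysis" "HOL-Algebra.Sym_Groups" "HOL-Algebra.Group_Action"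
begin

section \<open>Permutation actions\<close>

text \<open>
  A coordinate space \<open>\<real>\<^sup>I\<close> with a finite index set \<open>I\<close> is the set of extensional functions
  \<open>I \<rightarrow>\<^sub>E \<real>\<close>; in particular \<open>\<real>\<^sup>n\<close> is \<open>vecs {1..n}\<close>, which is the carrier of the
  topological space \<open>powertop_real {1..n}\<close>. Layers of a network carry arbitrary finite index
  sets instead of \<open>{1..d}\<close>, so that tensor coordinates need not be enumerated.
\<close>

definition vecs :: "'i set \<Rightarrow> ('i \<Rightarrow> real) set" where
  "vecs I = I \<rightarrow>\<^sub>E UNIV"

definition perm_act :: "'i set \<Rightarrow> ('i \<Rightarrow> 'i) \<Rightarrow> ('i \<Rightarrow> real) \<Rightarrow> 'i \<Rightarrow> real" where
  "perm_act I \<pi> x = (\<lambda>p\<in>I. x (inv_into I \<pi> p))"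

definition perm_group :: "nat \<Rightarrow> (nat \<Rightarrow> nat) set \<Rightarrow> (nat \<Rightarrow> nat) monoid" where
  "perm_group n G = (sym_group n)\<lparr>carrier := G\<rparr>"

definition layer_action ::
  "'g monoid \<Rightarrow> 'i set \<Rightarrow> ('g \<Rightarrow> ('i \<Rightarrow> real) \<Rightarrow> 'i \<Rightarrow> real) \<Rightarrow> bool" where
  "layer_action \<G> I A \<longleftrightarrow>
     (\<exists>\<phi>. faithful_action \<G> I \<phi> \<and>
          (\<forall>g\<in>carrier \<G>. \<forall>x\<in>vecs I. A g x = perm_act I (\<phi> g) x))"

section \<open>Orbits and cosets\<close>

text \<open>The first element \<open>i\<^sub>j\<close> of the \<open>j\<close>-th orbit.\<close>

definition orb_start :: "(nat \<Rightarrow> nat) \<Rightarrow> nat \<Rightarrow> nat" where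
  "orb_start l j = (\<Sum>k\<in>{1..<j}. l k) + 1"

definition Stab :: "nat \<Rightarrow> (nat \<Rightarrow> nat) set \<Rightarrow> nat \<Rightarrow> (nat \<Rightarrow> nat) set" where
  "Stab n G i = stabilizer (perm_group n G) (\<lambda>\<sigma>. \<sigma>) i"

definition orbit_data ::
  "nat \<Rightarrow> (nat \<Rightarrow> nat) set \<Rightarrow> nat \<Rightarrow> (nat \<Rightarrow> nat) \<Rightarrow> (nat \<Rightarrow> nat \<Rightarrow> nat \<Rightarrow> nat) \<Rightarrow> bool" where
  "orbit_data n G m l \<tau> \<longleftrightarrow>
     {1..n} = (\<Union>j\<in>{1..m}. orbit (perm_group n G) (\<lambda>\<sigma>. \<sigma>) (orb_start l j)) \<and>
     (\<forall>j\<in>{1..m}.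
        orbit (perm_group n G) (\<lambda>\<sigma>. \<sigma>) (orb_start l j) = {orb_start l j..<orb_start l j + l j} \<and>
        (\<forall>k\<in>{1..l j}. \<tau> j k \<in> G \<and> inv' (\<tau> j k) (orb_start l j) = orb_start l j + k - 1) \<and>
        G = (\<Union>k\<in>{1..l j}. Stab n G (orb_start l j) #>\<^bsub>sym_group n\<^esub> \<tau> j k) \<and>
        disjoint_family_on (\<lambda>k. Stab n G (orb_start l j) #>\<^bsub>sym_group n\<^esub> \<tau> j k) {1..l j})"

text \<open>The pair \<open>(j, k)\<close> with \<open>p = i\<^sub>j + k - 1\<close>.\<close>

definition locate :: "nat \<Rightarrow> (nat \<Rightarrow> nat) \<Rightarrow> nat \<Rightarrow> nat \<times> nat" where
  "locate m l p = (THE jk. case jk of (j, k) \<Rightarrow>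
     j \<in> {1..m} \<and> k \<in> {1..l j} \<and> p = orb_start l j + k - 1)"

text \<open>The element \<open>\<sigma>~\<^sub>j\<^sub>,\<^sub>k\<close> of \<open>Stab\<^sub>G(i\<^sub>j)\<close> attached to \<open>\<sigma>\<close> and the position \<open>p = i\<^sub>j + k - 1\<close>.\<close>

definition twist ::
  "nat \<Rightarrow> (nat \<Rightarrow> nat) set \<Rightarrow> nat \<Rightarrow> (nat \<Rightarrow> nat) \<Rightarrow> (nat \<Rightarrow> nat \<Rightarrow> nat \<Rightarrow> nat) \<Rightarrow>
   (nat \<Rightarrow> nat) \<Rightarrow> nat \<Rightarrow> nat \<Rightarrow> nat" where
  "twist n G m l \<tau> \<sigma> p = (case locate m l p of (j, k) \<Rightarrow>
     (THE \<rho>. \<rho> \<in> Stab n G (orb_start l j) \<and>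
             (\<exists>k'\<in>{1..l j}. \<rho> = \<tau> j k \<circ> \<sigma> \<circ> inv' (\<tau> j k'))))"

section \<open>ReLU networks\<close>

definition relu :: "real \<Rightarrow> real" where
  "relu x = max 0 x"

text \<open>
  The network \<open>Z\<^sub>H \<circ> \<dots> \<circ> Z\<^sub>1\<close> with \<open>H = depth N\<close>, where \<open>Z\<^sub>r\<close> maps \<open>vecs (coords N r)\<close> to
  \<open>vecs (coords N (r + 1))\<close>; the last block \<open>Z\<^sub>H\<close> has no activation.
\<close>

record 'i relu_network =
  depth :: nat
  coords :: "nat \<Rightarrow> 'i set"
  weight :: "nat \<Rightarrow> 'i \<Rightarrow> 'i \<Rightarrow> real"
  bias :: "nat \<Rightarrow> 'i \<Rightarrow> real"

definition well_formed :: "'i relu_network \<Rightarrow> bool" where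
  "well_formed N \<longleftrightarrow> 1 \<le> depth N \<and> (\<forall>r\<in>{1..depth N + 1}. finite (coords N r))"

definition affine_part :: "'i relu_network \<Rightarrow> nat \<Rightarrow> ('i \<Rightarrow> real) \<Rightarrow> 'i \<Rightarrow> real" where
  "affine_part N r x =
     (\<lambda>q\<in>coords N (r + 1). (\<Sum>p\<in>coords N r. weight N r q p * x p) + bias N r q)"

definition block :: "'i relu_network \<Rightarrow> nat \<Rightarrow> ('i \<Rightarrow> real) \<Rightarrow> 'i \<Rightarrow> real" where
  "block N r x =
     (if r < depth N then (\<lambda>q\<in>coords N (r + 1). relu (affine_part N r x q))
      else affine_part N r x)"

primrec run :: "'i relu_network \<Rightarrow> nat \<Rightarrow> ('i \<Rightarrow> real) \<Rightarrow> 'i \<Rightarrow> real" where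
  "run N 0 x = x"
| "run N (Suc r) x = block N (Suc r) (run N r x)"

definition represented :: "'i relu_network \<Rightarrow> ('i \<Rightarrow> real) \<Rightarrow> 'i \<Rightarrow> real" where
  "represented N = run N (depth N)"

text \<open>\<open>A r\<close> is the action on the \<open>r\<close>-th layer.\<close>

definition equivariant_network ::
  "'g monoid \<Rightarrow> 'i relu_network \<Rightarrow> (nat \<Rightarrow> 'g \<Rightarrow> ('i \<Rightarrow> real) \<Rightarrow> 'i \<Rightarrow> real) \<Rightarrow> bool" where
  "equivariant_network \<G> N A \<longleftrightarrow>
     well_formed N \<and>
     (\<forall>r\<in>{1..depth N + 1}. layer_action \<G> (coords N r) (A r)) \<and>
     (\<forall>r\<in>{1..depth N}. \<forall>g\<in>carrier \<G>. \<forall>x\<in>vecs (coords N r).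
        block N r (A r g x) = A (r + 1) g (block N r x))"

section \<open>Invariant networks in tensor form\<close>

text \<open>The coordinates \<open>(i\<^sub>1, \<dots>, i\<^sub>d; c)\<close> of \<open>\<real>\<close> to the power \<open>n\<^sup>d \<times> a\<close>.\<close>

type_synonym tensor_coord = "nat list \<times> nat"

definition tensor_coords :: "nat \<Rightarrow> nat \<Rightarrow> nat \<Rightarrow> tensor_coord set" where
  "tensor_coords n d a = {is. length is = d \<and> set is \<subseteq> {1..n}} \<times> {1..a}"

definition tensor_act ::
  "nat \<Rightarrow> nat \<Rightarrow> nat \<Rightarrow> (nat \<Rightarrow> nat) \<Rightarrow> (tensor_coord \<Rightarrow> real) \<Rightarrow> tensor_coord \<Rightarrow> real" where
  "tensor_act n d a \<sigma> X = (\<lambda>(is, c)\<in>tensor_coords n d a. X (map (inv' \<sigma>) is, c))"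

text \<open>The identification of \<open>\<real>\<^sup>n\<close> with the tensors of order 1 with one channel.\<close>

definition vec_tensor :: "nat \<Rightarrow> (nat \<Rightarrow> real) \<Rightarrow> tensor_coord \<Rightarrow> real" where
  "vec_tensor n x = (\<lambda>(is, c)\<in>tensor_coords n 1 1. x (hd is))"

text \<open>
  \<open>N\<close> is the part \<open>L\<^sub>H \<circ> ReLU \<circ> \<dots> \<circ> ReLU \<circ> L\<^sub>1\<close> of an invariant network; the final summation of
  entries is added in \<open>inv_value\<close>.
\<close>

definition invariant_tensor_network ::
  "nat \<Rightarrow> (nat \<Rightarrow> nat) set \<Rightarrow> (nat \<Rightarrow> nat) \<Rightarrow> (nat \<Rightarrow> nat) \<Rightarrow> tensor_coord relu_network \<Rightarrow> bool" where
  "invariant_tensor_network n H' d a N \<longleftrightarrow>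
     well_formed N \<and> d 1 = 1 \<and> a 1 = 1 \<and>
     (\<forall>r\<in>{1..depth N + 1}. coords N r = tensor_coords n (d r) (a r)) \<and>
     (\<forall>r\<in>{1..depth N}. \<forall>g\<in>H'. \<forall>X\<in>vecs (coords N r).
        affine_part N r (tensor_act n (d r) (a r) g X)
        = tensor_act n (d (r + 1)) (a (r + 1)) g (affine_part N r X))"

definition inv_value :: "nat \<Rightarrow> tensor_coord relu_network \<Rightarrow> (nat \<Rightarrow> real) \<Rightarrow> real" where
  "inv_value n N x = (\<Sum>q\<in>coords N (depth N + 1). represented N (vec_tensor n x) q)"

section \<open>The equivariant network\<close>

text \<open>
  Coordinates \<open>Inl p\<close> belong to the input and output layers \<open>\<real>\<^sup>n\<close>, coordinates \<open>Inr (p, q)\<close> to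
  the \<open>p\<close>-th of the \<open>n\<close> copies of a tensor layer.
\<close>

type_synonym stack_coord = "nat + nat \<times> tensor_coord"

definition to_layer :: "nat \<Rightarrow> (nat \<Rightarrow> real) \<Rightarrow> stack_coord \<Rightarrow> real" where
  "to_layer n x = (\<lambda>u\<in>Inl ` {1..n}. x (projl u))"

definition from_layer :: "nat \<Rightarrow> (stack_coord \<Rightarrow> real) \<Rightarrow> nat \<Rightarrow> real" where
  "from_layer n y = (\<lambda>p\<in>{1..n}. y (Inl p))"

text \<open>
  The network whose \<open>p\<close>-th component for
  \<open>p = i\<^sub>j + k - 1\<close> is \<open>N\<^sub>j \<circ> \<tau>\<^sub>j\<^sub>,\<^sub>k\<close>. The permutation \<open>\<tau>\<^sub>j\<^sub>,\<^sub>k\<close> is absorbed into the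
  first affine map (the coefficient of \<open>x\<^sub>i\<close> in \<open>W (\<tau> \<cdot> x)\<close> is that of \<open>x\<^bsub>\<tau>(i)\<^esub>\<close> in \<open>W x\<close>), the
  final summation into the last one, and distinct components do not interact. All \<open>N\<^sub>j\<close> have depth
  \<open>H\<close> and the same layer sizes \<open>d\<close>, \<open>a\<close>.
\<close>

definition stack_network ::
  "nat \<Rightarrow> nat \<Rightarrow> (nat \<Rightarrow> nat) \<Rightarrow> (nat \<Rightarrow> nat \<Rightarrow> nat \<Rightarrow> nat) \<Rightarrow> nat \<Rightarrow> (nat \<Rightarrow> nat) \<Rightarrow> (nat \<Rightarrow> nat) \<Rightarrow>
   (nat \<Rightarrow> tensor_coord relu_network) \<Rightarrow> stack_coord relu_network" where
  "stack_network n m l \<tau> H d a N =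
     (let net = (\<lambda>p. N (fst (locate m l p)));
          perm = (\<lambda>p. case locate m l p of (j, k) \<Rightarrow> \<tau> j k);
          final = (\<lambda>p. coords (net p) (H + 1))
      in \<lparr>depth = H,
          coords = (\<lambda>r. if r = 1 \<or> r = H + 1 then Inl ` {1..n}
                        else Inr ` ({1..n} \<times> tensor_coords n (d r) (a r))),
          weight = (\<lambda>r u v. case (u, v) of
              (Inr (p, q), Inl i) \<Rightarrow> weight (net p) r q ([perm p i], 1)
            | (Inr (p, q), Inr (p', q')) \<Rightarrow> if p = p' then weight (net p) r q q' else 0
            | (Inl p, Inr (p', q')) \<Rightarrow> if p = p' then \<Sum>q\<in>final p. weight (net p) r q q' else 0
            | (Inl p, Inl i) \<Rightarrow> \<Sum>q\<in>final p. weight (net p) r q ([perm p i], 1)),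
          bias = (\<lambda>r u. case u of
              Inr (p, q) \<Rightarrow> bias (net p) r q
            | Inl p \<Rightarrow> \<Sum>q\<in>final p. bias (net p) r q)\<rparr>)"

text \<open>
  For \<open>d \<ge> 1\<close> a hidden layer has underlying space \<open>\<real>\<^sup>n \<otimes> \<real>\<^sup>n \<otimes> V\<close>, where
  \<open>V = \<real>\<close> to the power \<open>n\<^bsup>d-1\<^esup> \<times> a\<close>: the coordinate \<open>Inr (p, (i # is, c))\<close> is that of
  \<open>e\<^sub>p \<otimes> e\<^sub>i \<otimes> v\<^bsub>is,c\<^esub>\<close>. The \<open>p\<close>-th block of \<open>\<sigma> \<cdot> X\<close> is \<open>\<sigma>~\<^sub>p \<cdot> X\<close> at block
  \<open>\<sigma>\<^sup>-\<^sup>1(p)\<close>, where \<open>\<sigma>~\<^sub>p\<close> acts on a block \<open>\<real>\<^sup>n \<otimes> V\<close> by the tensor action, that is, on all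
  \<open>d\<close> tensor indices. For \<open>d = 1\<close> this is the action on the factor \<open>\<real>\<^sup>n\<close> with trivial action
  on \<open>V\<close>. For \<open>d \<ge> 2\<close> the indices inside \<open>V\<close> have to be permuted as well: with layers of the
  trivial type only, every network that is equivariant for the alternating group on \<open>n \<ge> 6\<close>
  letters is equivariant for the whole symmetric group.
\<close>

definition hidden_act ::
  "nat \<Rightarrow> (nat \<Rightarrow> nat) set \<Rightarrow> nat \<Rightarrow> (nat \<Rightarrow> nat) \<Rightarrow> (nat \<Rightarrow> nat \<Rightarrow> nat \<Rightarrow> nat) \<Rightarrow> nat \<Rightarrow> nat \<Rightarrow>
   (nat \<Rightarrow> nat) \<Rightarrow> (stack_coord \<Rightarrow> real) \<Rightarrow> stack_coord \<Rightarrow> real" where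
  "hidden_act n G m l \<tau> d a \<sigma> X =
     (\<lambda>u\<in>Inr ` ({1..n} \<times> tensor_coords n d a). case projr u of (p, q) \<Rightarrow>
        tensor_act n d a (twist n G m l \<tau> \<sigma> p) (\<lambda>q'. X (Inr (inv' \<sigma> p, q'))) q)"

definition stack_action ::
  "nat \<Rightarrow> (nat \<Rightarrow> nat) set \<Rightarrow> nat \<Rightarrow> (nat \<Rightarrow> nat) \<Rightarrow> (nat \<Rightarrow> nat \<Rightarrow> nat \<Rightarrow> nat) \<Rightarrow> nat \<Rightarrow>
   (nat \<Rightarrow> nat) \<Rightarrow> (nat \<Rightarrow> nat) \<Rightarrow> nat \<Rightarrow> (nat \<Rightarrow> nat) \<Rightarrow> (stack_coord \<Rightarrow> real) \<Rightarrow> stack_coord \<Rightarrow> real" where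
  "stack_action n G m l \<tau> H d a r \<sigma> X =
     (if r = 1 \<or> r = H + 1 then to_layer n (perm_act {1..n} \<sigma> (from_layer n X))
      else hidden_act n G m l \<tau> (d r) (a r) \<sigma> X)"

section \<open>Uniform distance\<close>

text \<open>Valued in \<open>ennreal\<close>, so that the supremum over an empty set is 0.\<close>

definition sup_dist :: "('x \<Rightarrow> real) \<Rightarrow> ('x \<Rightarrow> real) \<Rightarrow> 'x set \<Rightarrow> ennreal" where
  "sup_dist f g K = (SUP x\<in>K. ennreal \<bar>f x - g x\<bar>)"

end

theory Submission
  imports Defs
begin

text \<open>
  Finite sums of functions \<open>exp (w \<bullet> x)\<close> are dense in \<open>C(K)\<close> by the Stone-Weierstrass theorem, and
  interpolating \<open>exp\<close> by a piecewise linear function turns such a sum into a ReLU network with one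
  hidden layer. Averaging a network \<open>h\<close> with \<open>a\<close> hidden units over a group \<open>S\<close> of permutations
  gives a network of tensor form: the coordinate \<open>((s 1, \<dots>, s n), c)\<close> of a hidden layer of order
  \<open>n\<close> computes the hidden unit \<open>c\<close> of \<open>h\<close> on the input \<open>s\<^sup>-\<^sup>1 \<cdot> x\<close>, and \<open>S\<close> permutes
  these coordinates. Averaging does not increase the distance to an \<open>S\<close>-invariant function.

  For \<open>p\<close> in the \<open>j\<close>-th orbit let \<open>\<tau>\<^sub>p \<in> G\<close> be the representative that moves \<open>p\<close> to \<open>i\<^sub>j\<close>. The
  identity \<open>\<tau>\<^sub>p \<sigma> = \<sigma>~\<^sub>p \<tau>\<^bsub>\<sigma>\<^sup>-\<^sup>1(p)\<^esub>\<close> with \<open>\<sigma>~\<^sub>p\<close> in the stabilizer of \<open>i\<^sub>j\<close>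
  turns the invariance of the \<open>j\<close>-th network into equivariance of the stack, and
  \<open>f\<^sub>p(x) = f\<^bsub>i\<^sub>j\<^esub>(\<tau>\<^sub>p \<cdot> x)\<close> transports the error estimate from \<open>i\<^sub>j\<close> to \<open>p\<close>.
\<close>

section \<open>Density of shallow ReLU networks\<close>

inductive_set fun_span :: "('a \<Rightarrow> real) set \<Rightarrow> ('a \<Rightarrow> real) set" for B where
  zero: "(\<lambda>x. 0) \<in> fun_span B"
| step: "f \<in> fun_span B \<Longrightarrow> b \<in> B \<Longrightarrow> (\<lambda>x. f x + c * b x) \<in> fun_span B"

lemma fun_span_base: "b \<in> B \<Longrightarrow> (\<lambda>x. c * b x) \<in> fun_span B"
  using fun_span.step[OF fun_span.zero, of b B c] by simp

lemma fun_span_add: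
  assumes "f \<in> fun_span B" "g \<in> fun_span B"
  shows "(\<lambda>x. f x + g x) \<in> fun_span B"
  using assms(2)
proof induction
  case (step g b c)
  then show ?case using fun_span.step[OF step.IH step.hyps(2), of c] by (simp add: algebra_simps)
qed (simp add: assms(1))

lemma fun_span_scale:
  assumes "f \<in> fun_span B"
  shows "(\<lambda>x. c * f x) \<in> fun_span B"
  using assms
proof induction
  case (step f b k)
  then show ?case using fun_span.step[OF step.IH step.hyps(2), of "c * k"] by (simp add: algebra_simps)
qed (simp add: fun_span.zero)

text \<open>Bilinearity, with one induction for each factor. Applied to exponentials it yields the
  algebra that Stone-Weierstrass requires.\<close>

lemma fun_span_mult:
  assumes B: "\<And>b b'. b \<in> B \<Longrightarrow> b' \<in> B \<Longrightarrow> (\<lambda>x. b x * b' x) \<in> B"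
    and "f \<in> fun_span B" "g \<in> fun_span B"
  shows "(\<lambda>x. f x * g x) \<in> fun_span B"
  using assms(2)
proof induction
  case (step f b c)
  have "(\<lambda>x. b x * g x) \<in> fun_span B"
    using assms(3)
  proof induction
    case (step g b' k)
    then show ?case
      using fun_span.step[OF step.IH B[OF \<open>b \<in> B\<close> step.hyps(2)], of k] by (simp add: algebra_simps)
  qed (simp add: fun_span.zero)
  from fun_span_add[OF step.IH fun_span_scale[OF this, of c]]
  show ?case by (simp add: algebra_simps)
qed (simp add: fun_span.zero)

lemma fun_span_comp:
  assumes "f \<in> fun_span B" "\<And>b. b \<in> B \<Longrightarrow> (\<lambda>x. b (h x)) \<in> C"
  shows "(\<lambda>x. f (h x)) \<in> fun_span C"
  using assms(1)
  by induction (auto intro: fun_span.intros assms(2) fun_span.step[where b = "\<lambda>x. _ (h x)"])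

text \<open>Gives the explicit sum in which each summand becomes one channel of the hidden
  layer.\<close>

lemma fun_span_combination:
  assumes "f \<in> fun_span B"
  obtains a :: nat and \<beta> b where "\<And>c. c \<in> {1..a} \<Longrightarrow> b c \<in> B" "\<And>x. f x = (\<Sum>c = 1..a. \<beta> c * b c x)"
proof -
  have "\<exists>(a::nat) \<beta> b. (\<forall>c\<in>{1..a}. b c \<in> B) \<and> (\<forall>x. f x = (\<Sum>c = 1..a. \<beta> c * b c x))"
    using assms
  proof induction
    case zero
    show ?case by (rule exI[of _ 0]) auto
  next
    case (step f b' k)
    then obtain a :: nat and \<beta> b where *: "\<forall>c\<in>{1..a}. b c \<in> B" "\<forall>x. f x = (\<Sum>c = 1..a. \<beta> c * b c x)"
      by blast
    show ?case
    proof (intro exI conjI ballI allI)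
      show "(b(Suc a := b')) c \<in> B" if "c \<in> {1..Suc a}" for c
        using that * step by auto
      show "f x + k * b' x = (\<Sum>c = 1..Suc a. (\<beta>(Suc a := k)) c * (b(Suc a := b')) c x)" for x
        using * by (auto intro!: sum.cong)
    qed
  qed
  then show ?thesis using that by blast
qed

text \<open>The errors of the finitely many summands add up, so each induction step spends half of
  \<epsilon>. This serves to replace exponentials by ReLU units.\<close>

lemma fun_span_approximation:
  assumes C: "\<And>b \<epsilon>. b \<in> B \<Longrightarrow> 0 < \<epsilon> \<Longrightarrow> \<exists>g\<in>fun_span C. \<forall>x\<in>K. \<bar>g x - b x\<bar> \<le> \<epsilon>"
    and "f \<in> fun_span B" "0 < (\<epsilon>::real)"
  shows "\<exists>g\<in>fun_span C. \<forall>x\<in>K. \<bar>g x - f x\<bar> \<le> \<epsilon>"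
  using assms(2,3)
proof (induction arbitrary: \<epsilon>)
  case zero
  then show ?case by (auto intro!: bexI[OF _ fun_span.zero])
next
  case (step f b c)
  from step.IH[of "\<epsilon>/2"] step.prems obtain g where g: "g \<in> fun_span C" "\<forall>x\<in>K. \<bar>g x - f x\<bar> \<le> \<epsilon>/2"
    by auto
  \<comment> \<open>The \<open>1 +\<close> keeps the denominator positive when
    \<open>c = 0\<close>.\<close>
  from C[OF step.hyps(2), of "\<epsilon> / 2 / (1 + \<bar>c\<bar>)"] step.prems
  obtain g' where g': "g' \<in> fun_span C" "\<forall>x\<in>K. \<bar>g' x - b x\<bar> \<le> \<epsilon> / 2 / (1 + \<bar>c\<bar>)"
    by (auto simp: divide_pos_pos)
  show ?case
  proof (intro bexI ballI)
    show "(\<lambda>x. g x + c * g' x) \<in> fun_span C"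
      using g g' fun_span_add fun_span_scale by blast
    fix x assume x: "x \<in> K"
    have "\<bar>c * (g' x - b x)\<bar> \<le> (1 + \<bar>c\<bar>) * (\<epsilon> / 2 / (1 + \<bar>c\<bar>))"
      unfolding abs_mult using g' x by (intro mult_mono) auto
    also have "\<dots> = \<epsilon> / 2" by (simp add: field_simps add_nonneg_eq_0_iff)
    finally have 1: "\<bar>c * (g' x - b x)\<bar> \<le> \<epsilon> / 2" .
    have "g x + c * g' x - (f x + c * b x) = (g x - f x) + c * (g' x - b x)"
      by (simp add: algebra_simps)
    then show "\<bar>g x + c * g' x - (f x + c * b x)\<bar> \<le> \<epsilon>"
      using 1 g x by (smt (verit) field_sum_of_halves)
  qed
qed

section \<open>Piecewise linear interpolation on an interval by ReLU functions\<close>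

lemma relu_interpolation:
  fixes g :: "real \<Rightarrow> real"
  assumes "continuous_on {s..t} g" "0 < \<epsilon>"
  shows "\<exists>f\<in>fun_span {r. \<exists>w b. \<forall>u. r u = relu (w * u + b)}. \<forall>u\<in>{s..t}. \<bar>f u - g u\<bar> \<le> \<epsilon>"
proof (cases "s < t")
  case False
  \<comment> \<open>The interval is empty or the single point \<open>s\<close>;
    \<open>relu (0 * u + 1)\<close> is the constant 1.\<close>
  have "(\<lambda>u. g s * relu (0 * u + 1)) \<in> fun_span {r. \<exists>w b. \<forall>u. r u = relu (w * u + b)}"
    by (rule fun_span_base) blast
  then show ?thesis
    using False \<open>0 < \<epsilon>\<close> by (intro bexI ballI) (auto simp: relu_def not_less dest: order_antisym)
next
  case True
  let ?R = "fun_span {r. \<exists>w b. \<forall>u. r u = relu (w * u + b)}"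
  have "uniformly_continuous_on {s..t} g"
    using assms(1) by (intro compact_uniformly_continuous) auto
  then obtain \<delta> where \<delta>: "0 < \<delta>" "\<And>u v. u \<in> {s..t} \<Longrightarrow> v \<in> {s..t} \<Longrightarrow> \<bar>u - v\<bar> < \<delta> \<Longrightarrow> \<bar>g u - g v\<bar> < \<epsilon>"
    using assms(2) unfolding uniformly_continuous_on_def dist_real_def by metis
  \<comment> \<open>With this number of pieces the mesh \<open>h\<close> stays below
    \<delta>.\<close>
  obtain M :: nat where M: "(t - s) / \<delta> < M" using reals_Archimedean2 by blast
  with True \<delta> have M0: "0 < M" by (metis divide_pos_pos diff_gt_0_iff_gt of_nat_0_less_iff less_trans)
  define h where "h = (t - s) / M"
  define p where "p k = s + real k * h" for k
  have h: "0 < h" "h < \<delta>"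
    using True M M0 \<delta> by (auto simp: h_def field_simps)
  have pM: "p M = t" using M0 by (simp add: p_def h_def)
  have pS: "p (Suc k) = p k + h" for k by (simp add: p_def algebra_simps)
  have p_in: "p k \<in> {s..t}" if "k \<le> M" for k
  proof -
    have "real k * h \<le> real M * h" using that h by (intro mult_right_mono) auto
    then show ?thesis using pM h by (auto simp: p_def)
  qed
  \<comment> \<open>The interpolant is built from left to right; being constant beyond
    \<open>p k\<close>, it has a known value on the piece that comes next.\<close>
  have "\<exists>f\<in>?R. (\<forall>u\<in>{s..p k}. \<bar>f u - g u\<bar> \<le> \<epsilon>) \<and> (\<forall>u\<ge>p k. f u = g (p k))" if "k \<le> M" for k
    using that
  proof (induction k)
    case 0
    have "(\<lambda>u. g s * relu (0 * u + 1)) \<in> ?R"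
      by (rule fun_span_base) blast
    then show ?case
      using \<open>0 < \<epsilon>\<close> by (intro bexI) (auto simp: relu_def p_def)
  next
    case (Suc k)
    then obtain f where f: "f \<in> ?R" "\<forall>u\<in>{s..p k}. \<bar>f u - g u\<bar> \<le> \<epsilon>" "\<forall>u\<ge>p k. f u = g (p k)"
      by auto
    let ?c = "(g (p (Suc k)) - g (p k)) / h"
    \<comment> \<open>The first new unit switches the slope \<open>?c\<close> on at
      \<open>p k\<close>, the second switches it off at \<open>p (Suc k)\<close>; both vanish to the
      left of \<open>p k\<close>.\<close>
    let ?f = "\<lambda>u. f u + ?c * relu (1 * u + - p k) + - ?c * relu (1 * u + - p (Suc k))"
    have "?f \<in> ?R"
      by (intro fun_span.step f) blast+
    moreover have "?f u = g (p (Suc k))" if "u \<ge> p (Suc k)" for u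
    proof -
      have "f u = g (p k)" using f that pS h by auto
      moreover have "relu (1 * u + - p k) - relu (1 * u + - p (Suc k)) = h"
        using that pS[of k] h by (auto simp: relu_def)
      moreover have "?f u = f u + ?c * (relu (1 * u + - p k) - relu (1 * u + - p (Suc k)))"
        by (simp add: algebra_simps)
      ultimately show ?thesis using h by simp
    qed
    moreover have "\<bar>?f u - g u\<bar> \<le> \<epsilon>" if u: "u \<in> {s..p (Suc k)}" for u
    proof (cases "u \<le> p k")
      case True
      then have "?f u = f u" using pS[of k] h by (auto simp: relu_def)
      then show ?thesis using f True u by auto
    next
      case False
      define \<theta> where "\<theta> = (u - p k) / h"
      have \<theta>: "0 \<le> \<theta>" "\<theta> \<le> 1" using False u pS[of k] h by (auto simp: \<theta>_def field_simps)
      have u': "u \<in> {s..t}" using u p_in[OF \<open>Suc k \<le> M\<close>] by auto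
      have 1: "\<bar>g (p k) - g u\<bar> \<le> \<epsilon>"
        using \<delta>(2)[OF p_in[of k] u'] Suc.prems False u pS[of k] h by auto
      have 2: "\<bar>g (p (Suc k)) - g u\<bar> \<le> \<epsilon>"
        using \<delta>(2)[OF p_in[OF Suc.prems] u'] False u pS[of k] h by auto
      have "?f u = g (p k) + ?c * (u - p k)"
        using False u f by (auto simp: relu_def)
      also have "\<dots> = g (p k) + (g (p (Suc k)) - g (p k)) * \<theta>"
        by (simp add: \<theta>_def)
      \<comment> \<open>The error at \<open>u\<close> is a convex combination of the differences
        between \<open>g u\<close> and the values of \<open>g\<close> at the two neighbouring nodes,
        both closer to \<open>u\<close> than \<delta>.\<close>
      finally have "?f u - g u = (1 - \<theta>) * (g (p k) - g u) + \<theta> * (g (p (Suc k)) - g u)"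
        by (simp add: algebra_simps)
      also have "\<bar>\<dots>\<bar> \<le> (1 - \<theta>) * \<epsilon> + \<theta> * \<epsilon>"
        using \<theta> 1 2 by (intro order_trans[OF abs_triangle_ineq] add_mono)
          (auto simp: abs_mult intro!: mult_left_mono)
      finally show ?thesis by (simp add: algebra_simps)
    qed
    ultimately show ?case by (intro bexI[of _ ?f]) auto
  qed
  from this[of M] show ?thesis using pM by auto
qed

section \<open>Stone-Weierstrass with exponentials, then passage to ReLU units\<close>

definition exp_units :: "nat set \<Rightarrow> ((nat \<Rightarrow> real) \<Rightarrow> real) set" where
  "exp_units I = {u. \<exists>w. \<forall>x. u x = exp (\<Sum>i\<in>I. w i * x i)}"

definition relu_units :: "nat set \<Rightarrow> ((nat \<Rightarrow> real) \<Rightarrow> real) set" where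
  "relu_units I = {u. \<exists>w b. \<forall>x. u x = relu ((\<Sum>i\<in>I. w i * x i) + b)}"

text \<open>Exponentials of linear forms are closed under products, so their span is an algebra, to
  which Stone-Weierstrass applies. Each exponential is a univariate function of a linear form, and a
  ReLU interpolation of \<open>exp\<close> composed with that form lies in the span of ReLU
  units.\<close>

lemma fun_span_relu_units_dense:
  fixes K :: "(nat \<Rightarrow> real) set"
  assumes "compact K" "K \<subseteq> vecs I" "finite I" "continuous_on K f" "0 < \<epsilon>"
  shows "\<exists>g\<in>fun_span (relu_units I). \<forall>x\<in>K. \<bar>f x - g x\<bar> \<le> \<epsilon>"
proof -
  let ?E = "exp_units I" and ?C = "relu_units I"
  have coord: "continuous_on K (\<lambda>x. x i)" for i
    by (rule continuous_on_subset[OF continuous_on_product_coordinates]) simp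
  have lin: "continuous_on K (\<lambda>x. \<Sum>i\<in>I. w i * x i)" for w
    by (intro continuous_intros coord)
  interpret function_ring_on "fun_span ?E" K
  proof
    show "compact K" by fact
    show "continuous_on K f" if "f \<in> fun_span ?E" for f
      using that
    proof induction
      case (step f b c)
      then obtain w where "\<forall>x. b x = exp (\<Sum>i\<in>I. w i * x i)" by (auto simp: exp_units_def)
      then have "continuous_on K b"
        using continuous_on_exp[OF lin] by (simp cong: continuous_on_cong)
      then show ?case
        by (intro continuous_on_add continuous_on_mult continuous_on_const step.IH)
    qed simp
    show "(\<lambda>x. f x * g x) \<in> fun_span ?E" if "f \<in> fun_span ?E" "g \<in> fun_span ?E" for f g
    proof (rule fun_span_mult[OF _ that])
      fix b b' assume "b \<in> ?E" "b' \<in> ?E"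
      then obtain w w' where w: "\<And>x. b x = exp (\<Sum>i\<in>I. w i * x i)" "\<And>x. b' x = exp (\<Sum>i\<in>I. w' i * x i)"
        by (auto simp: exp_units_def)
      have "b x * b' x = exp (\<Sum>i\<in>I. (w i + w' i) * x i)" for x
        by (simp add: w exp_add[symmetric] sum.distrib ring_distribs)
      then show "(\<lambda>x. b x * b' x) \<in> ?E" unfolding exp_units_def by (intro CollectI exI[of _ "\<lambda>i. w i + w' i"]) simp
    qed
    show "(\<lambda>_. c) \<in> fun_span ?E" for c
    proof -
      have "(\<lambda>x. c * exp (\<Sum>i\<in>I. 0 * x i)) \<in> fun_span ?E"
        by (rule fun_span_base) (unfold exp_units_def, intro CollectI exI[of _ "\<lambda>i. 0"], simp)
      then show ?thesis by simp
    qed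
    show "\<exists>f\<in>fun_span ?E. f x \<noteq> f y" if xy: "x \<in> K" "y \<in> K" "x \<noteq> y" for x y
    proof -
      \<comment> \<open>Elements of \<open>vecs I\<close> agree outside \<open>I\<close>, so
        distinct ones differ at an index in \<open>I\<close>; the exponential of that coordinate
        separates them.\<close>
      obtain i where i: "i \<in> I" "x i \<noteq> y i"
        using xy assms(2) PiE_ext[of x I "\<lambda>_. UNIV" y] unfolding vecs_def by blast
      let ?w = "\<lambda>k. if k = i then 1 else 0 :: real"
      have *: "(\<Sum>k\<in>I. ?w k * z k) = z i" for z :: "nat \<Rightarrow> real"
        using i(1) assms(3) by (simp add: if_distrib[of "\<lambda>u. u * _"] sum.delta cong: if_cong)
      have "(\<lambda>z. 1 * exp (\<Sum>k\<in>I. ?w k * z k)) \<in> fun_span ?E"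
        by (rule fun_span_base) (unfold exp_units_def, intro CollectI exI[of _ ?w], simp)
      then show ?thesis using i(2) unfolding * by (intro bexI) auto
    qed
  qed (rule fun_span_add)
  have exp_approx: "\<exists>g\<in>fun_span ?C. \<forall>x\<in>K. \<bar>g x - b x\<bar> \<le> e" if b: "b \<in> ?E" and "0 < e" for b e
  proof -
    obtain w where w: "\<And>x. b x = exp (\<Sum>i\<in>I. w i * x i)" using b by (auto simp: exp_units_def)
    have "bounded ((\<lambda>x. \<Sum>i\<in>I. w i * x i) ` K)"
      by (intro compact_imp_bounded compact_continuous_image lin \<open>compact K\<close>)
    \<comment> \<open>The linear form takes its values on \<open>K\<close> in
      \<open>{-M..M}\<close>, so interpolating \<open>exp\<close> there controls the error on all of
      \<open>K\<close>.\<close>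
    then obtain M where M: "\<And>x. x \<in> K \<Longrightarrow> \<bar>\<Sum>i\<in>I. w i * x i\<bar> \<le> M"
      unfolding bounded_iff by auto
    obtain g where g: "g \<in> fun_span {r. \<exists>w b. \<forall>u. r u = relu (w * u + b)}" "\<forall>u\<in>{-M..M}. \<bar>g u - exp u\<bar> \<le> e"
      using relu_interpolation[OF continuous_on_exp[OF continuous_on_id] \<open>0 < e\<close>] by blast
    show ?thesis
    proof (intro bexI ballI)
      show "(\<lambda>x. g (\<Sum>i\<in>I. w i * x i)) \<in> fun_span ?C"
      proof (rule fun_span_comp[OF g(1)])
        fix b assume "b \<in> {r. \<exists>w b. \<forall>u. r u = relu (w * u + b)}"
        then obtain v c where b: "\<And>u. b u = relu (v * u + c)" by auto
        show "(\<lambda>x. b (\<Sum>i\<in>I. w i * x i)) \<in> ?C"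
          unfolding relu_units_def by (intro CollectI exI[of _ "\<lambda>i. v * w i"] exI[of _ c])
            (simp add: b sum_distrib_left mult.assoc)
      qed
      show "\<bar>g (\<Sum>i\<in>I. w i * x i) - b x\<bar> \<le> e" if "x \<in> K" for x
        using g(2) M[OF that] by (auto simp: w abs_le_iff)
    qed
  qed
  obtain h where h: "h \<in> fun_span ?E" "\<forall>x\<in>K. \<bar>f x - h x\<bar> < \<epsilon> / 2"
    using Stone_Weierstrass_basic[OF assms(4), of "\<epsilon> / 2"] assms(5) by auto
  obtain g where g: "g \<in> fun_span ?C" "\<forall>x\<in>K. \<bar>g x - h x\<bar> \<le> \<epsilon> / 2"
    using fun_span_approximation[OF exp_approx h(1), of "\<epsilon> / 2"] assms(5) by auto
  show ?thesis
  proof (intro bexI ballI)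
    show "\<bar>f x - g x\<bar> \<le> \<epsilon>" if "x \<in> K" for x
      using h(2) g(2) that by (smt (verit) field_sum_of_halves)
  qed (rule g)
qed

section \<open>Passage between the topology of \<open>vecs I\<close> and that of the full function
  space\<close>

lemma compactin_powertop_imp_compact:
  assumes "compactin (powertop_real I) K"
  shows "compact (K :: (nat \<Rightarrow> real) set)"
proof -
  \<comment> \<open>A coordinate outside \<open>I\<close> is constantly \<open>undefined\<close> on
    extensional functions, so the inclusion into the full function space is continuous in every
    component.\<close>
  have "continuous_map (powertop_real I) euclideanreal (\<lambda>x. x i)" for i :: nat
  proof (cases "i \<in> I")
    case False
    have "undefined = x i" if "x \<in> topspace (powertop_real I)" for x
      using that False by (simp add: PiE_arb[of x I "\<lambda>_. UNIV"])
    then show ?thesis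
      by (intro continuous_map_eq[of "powertop_real I" euclideanreal "\<lambda>x. undefined" "\<lambda>x. x i"]) simp
  next
    case True
    then show ?thesis by (rule continuous_map_product_projection)
  qed
  then have "continuous_map (powertop_real I) (powertop_real UNIV) (\<lambda>x. x)"
    by (simp add: continuous_map_componentwise_UNIV)
  then have "continuous_map (powertop_real I) euclidean (\<lambda>x. x)"
    by (simp only: euclidean_product_topology)
  from image_compactin[OF assms this] show ?thesis by simp
qed

lemma continuous_map_powertop_imp_continuous_on:
  assumes "continuous_map (subtopology (powertop_real I) K) euclideanreal f" "K \<subseteq> vecs I"
  shows "continuous_on (K :: (nat \<Rightarrow> real) set) f"
proof -
  have "continuous_map (top_of_set K) (powertop_real I) (\<lambda>x. x)"
    using assms(2) by (subst continuous_map_componentwise)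
      (auto simp: vecs_def PiE_def intro!: continuous_on_subset[OF continuous_on_product_coordinates])
  then have "continuous_map (top_of_set K) (subtopology (powertop_real I) K) (\<lambda>x. x)"
    by (simp add: continuous_map_in_subtopology)
  from continuous_map_compose[OF this assms(1)] show ?thesis by (simp add: o_def)
qed

text \<open>Having this for all large widths lets finitely many orbits share one width
  later.\<close>

lemma shallow_relu_approximation:
  fixes K :: "(nat \<Rightarrow> real) set"
  assumes "finite I" "compactin (powertop_real I) K"
    and "continuous_map (subtopology (powertop_real I) K) euclideanreal f" "0 < \<epsilon>"
  shows "\<forall>\<^sub>F a in sequentially. \<exists>\<beta> w b. \<forall>x\<in>K.
    \<bar>f x - (\<Sum>c = 1..a. \<beta> c * relu ((\<Sum>i\<in>I. w c i * x i) + b c))\<bar> \<le> \<epsilon>"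
proof -
  have K: "K \<subseteq> vecs I"
    using assms(2) by (auto simp: compactin_def vecs_def)
  obtain g where g: "g \<in> fun_span (relu_units I)"
    "\<forall>x\<in>K. \<bar>f x - g x\<bar> \<le> \<epsilon>"
    using fun_span_relu_units_dense[OF compactin_powertop_imp_compact[OF assms(2)] K assms(1)
        continuous_map_powertop_imp_continuous_on[OF assms(3) K] assms(4)] by blast
  from fun_span_combination[OF g(1)] obtain a0 :: nat and \<beta> u where
    u: "\<And>c. c \<in> {1..a0} \<Longrightarrow> u c \<in> relu_units I"
    and g': "\<And>x. g x = (\<Sum>c = 1..a0. \<beta> c * u c x)" by metis
  then have "\<forall>c\<in>{1..a0}. \<exists>w b. \<forall>x. u c x = relu ((\<Sum>i\<in>I. w i * x i) + b)" by (simp add: relu_units_def)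
  then obtain w b where wb: "\<And>c x. c \<in> {1..a0} \<Longrightarrow> u c x = relu ((\<Sum>i\<in>I. w c i * x i) + b c)"
    by metis
  show ?thesis
  proof (rule eventually_sequentiallyI[of a0], intro exI ballI)
    fix a x assume a: "a0 \<le> a" and x: "x \<in> K"
    \<comment> \<open>Units beyond \<open>a0\<close> get coefficient 0, so padding does not change
      the sum.\<close>
    have "(\<Sum>c = 1..a. (if c \<le> a0 then \<beta> c else 0) * relu ((\<Sum>i\<in>I. w c i * x i) + b c))
      = (\<Sum>c = 1..a0. (if c \<le> a0 then \<beta> c else 0) * relu ((\<Sum>i\<in>I. w c i * x i) + b c))"
      using a by (intro sum.mono_neutral_right) auto
    also have "\<dots> = g x" unfolding g' by (intro sum.cong) (auto simp: wb)
    finally show "\<bar>f x - (\<Sum>c = 1..a. (if c \<le> a0 then \<beta> c else 0) * relu ((\<Sum>i\<in>I. w c i * x i) + b c))\<bar> \<le> \<epsilon>"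
      using g(2) x by simp
  qed
qed

section \<open>Symmetrization over a permutation group\<close>

lemma sym_subgroupD:
  assumes "subgroup S (sym_group n)"
  shows "g \<in> S \<Longrightarrow> g permutes {1..n}" "id \<in> S" "g \<in> S \<Longrightarrow> h \<in> S \<Longrightarrow> g \<circ> h \<in> S"
    "g \<in> S \<Longrightarrow> inv' g \<in> S" "finite S"
proof -
  show *: "g permutes {1..n}" if "g \<in> S" for g
    using subgroup.mem_carrier[OF assms that] by (simp add: sym_group_carrier)
  show "id \<in> S" using subgroup.one_closed[OF assms] by (simp add: sym_group_one)
  show "g \<circ> h \<in> S" if "g \<in> S" "h \<in> S" for g h
    using subgroup.m_closed[OF assms that] by (simp add: sym_group_mult)
  show "inv' g \<in> S" if "g \<in> S" for g
    using subgroup.m_inv_closed[OF assms that] * that by (simp add: sym_group_carrier)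
  show "finite S"
    by (rule finite_subset[OF _ finite_permutations[of "{1..n}"]]) (use * in auto)
qed

lemma permutes_inv_into:
  assumes "g permutes A" "p \<in> A"
  shows "inv_into A g p = inv' g p"
  using inv_into_f_f[of g A "inv' g p"] assms
  by (simp add: permutes_inj_on permutes_inverses permutes_in_image[OF permutes_inv])

lemma perm_act_apply:
  assumes "g permutes I" "p \<in> I"
  shows "perm_act I g x p = x (inv' g p)"
  using assms by (simp add: perm_act_def permutes_inv_into)

lemma finite_tensor_coords [simp]: "finite (tensor_coords n d a)"
proof -
  have "finite {is. set is \<subseteq> {1..n} \<and> length is = d}"
    by (rule finite_lists_length_eq) simp
  then show ?thesis
    unfolding tensor_coords_def by (intro finite_cartesian_product) (simp_all add: conj_commute)
qed

lemma tensor_coords_order1: "tensor_coords n 1 1 = (\<lambda>i. ([i], 1)) ` {1..n}"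
  by (auto simp: tensor_coords_def length_Suc_conv)

lemma tensor_coords_order0: "tensor_coords n 0 1 = {([], 1)}"
  by (auto simp: tensor_coords_def)

lemma map_perm_tensor_coords:
  assumes "g permutes {1..n}"
  shows "(map g is, c) \<in> tensor_coords n d a \<longleftrightarrow> (is, c) \<in> tensor_coords n d a"
  using permutes_in_image[OF assms] by (auto simp: tensor_coords_def)

text \<open>Serves as the tensor index of order \<open>n\<close> that labels the copy of the hidden
  units belonging to \<open>s\<close>.\<close>

definition perm_list :: "nat \<Rightarrow> (nat \<Rightarrow> nat) \<Rightarrow> nat list" where
  "perm_list n s = map s [1..<Suc n]"

lemma nth_perm_list: "k \<in> {1..n} \<Longrightarrow> perm_list n s ! (k - 1) = s k"
  by (cases k) (auto simp: perm_list_def nth_map_upt simp del: upt_Suc)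

lemma set_perm_list: "set (perm_list n s) = s ` {1..n}"
  by (simp add: perm_list_def atLeastLessThanSuc_atLeastAtMost del: upt_Suc)

lemma length_perm_list: "length (perm_list n s) = n"
  by (simp add: perm_list_def)

text \<open>Turns the tensor action on indices into left multiplication, under which a sum over a
  group is invariant.\<close>

lemma map_perm_list: "map g (perm_list n s) = perm_list n (g \<circ> s)"
  by (simp add: perm_list_def)

text \<open>\<open>max 1 n\<close> instead of \<open>n\<close>, because a hidden layer must have positive order even if
  \<open>n = 0\<close>.\<close>

definition sym_order :: "nat \<Rightarrow> nat \<Rightarrow> nat" where
  "sym_order n r = (if r = 1 then 1 else if r = 2 then max 1 n else 0)"

definition sym_channels :: "nat \<Rightarrow> nat \<Rightarrow> nat" where
  "sym_channels a r = (if r = 2 then a else 1)"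

text \<open>The list \<open>is\<close> selects the input \<open>(x\<^bsub>is!0\<^esub>, \<dots>, x\<^bsub>is!(n-1)\<^esub>)\<close>. The first layer
  evaluates the hidden units on all such inputs, the second one discards the lists that do not come
  from \<open>S\<close>.\<close>

definition symmetrized_network ::
  "nat \<Rightarrow> (nat \<Rightarrow> nat) set \<Rightarrow> nat \<Rightarrow> (nat \<Rightarrow> real) \<Rightarrow> (nat \<Rightarrow> nat \<Rightarrow> real) \<Rightarrow> (nat \<Rightarrow> real) \<Rightarrow>
   tensor_coord relu_network" where
  "symmetrized_network n S a \<beta> w b =
     \<lparr>depth = 2,
      coords = (\<lambda>r. tensor_coords n (sym_order n r) (sym_channels a r)),
      weight = (\<lambda>r (is, c) (is', c').
        if r = 1 then \<Sum>k = 1..n. if is ! (k - 1) = hd is' then w c k else 0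
        else if is' \<in> perm_list n ` S then \<beta> c' / card S else 0),
      bias = (\<lambda>r (is, c). if r = 1 then b c else 0)\<rparr>"

section \<open>Values, invariance and error of the symmetrized network\<close>

locale symmetrization =
  fixes n :: nat and S :: "(nat \<Rightarrow> nat) set" and a :: nat
    and \<beta> :: "nat \<Rightarrow> real" and w :: "nat \<Rightarrow> nat \<Rightarrow> real" and b :: "nat \<Rightarrow> real"
  assumes n: "1 \<le> n" and S: "subgroup S (sym_group n)"
begin

abbreviation "\<N> \<equiv> symmetrized_network n S a \<beta> w b"

text \<open>The weight at input \<open>i\<close> collects all positions \<open>k\<close> with
  \<open>is ! (k - 1) = i\<close>, so repeated entries of \<open>is\<close> are accounted for;
  exchanging the sums leaves one input for each \<open>k\<close>.\<close>

lemma affine_part_1: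
  assumes "(is, c) \<in> tensor_coords n n a"
  shows "affine_part \<N> 1 X (is, c) = (\<Sum>k = 1..n. w c k * X ([is ! (k - 1)], 1)) + b c"
proof -
  have "is ! (k - 1) \<in> {1..n}" if "k \<in> {1..n}" for k
    using assms that nth_mem[of "k - 1" "is"] by (fastforce simp: tensor_coords_def)
  then have *: "(\<Sum>i = 1..n. (if is ! (k - 1) = i then w c k else 0) * X ([i], 1))
      = w c k * X ([is ! (k - 1)], 1)" if "k \<in> {1..n}" for k
    using that by (simp add: if_distrib[of "\<lambda>u. u * _"] cong: if_cong)
  have "affine_part \<N> 1 X (is, c)
    = (\<Sum>i = 1..n. (\<Sum>k = 1..n. if is ! (k - 1) = i then w c k else 0) * X ([i], 1)) + b c"
    using assms n unfolding affine_part_def symmetrized_network_def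
    by (simp add: sym_order_def sym_channels_def max_absorb2 tensor_coords_order1[unfolded One_nat_def] sum.reindex inj_on_def)
  also have "(\<Sum>i = 1..n. (\<Sum>k = 1..n. if is ! (k - 1) = i then w c k else 0) * X ([i], 1))
    = (\<Sum>k = 1..n. w c k * X ([is ! (k - 1)], 1))"
    unfolding sum_distrib_right by (subst sum.swap) (intro sum.cong refl *)
  finally show ?thesis .
qed

text \<open>A permutation of \<open>{1..n}\<close> is the identity elsewhere, so its list of values
  determines it. Sums over lists can then be reindexed by \<open>S\<close>.\<close>

lemma inj_on_map_perm: "inj_on (perm_list n) S"
proof (rule inj_onI, rule ext)
  fix s s' i assume *: "s \<in> S" "s' \<in> S" "perm_list n s = perm_list n s'"
  show "s i = s' i"
  proof (cases "i \<in> {1..n}")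
    case True
    then show ?thesis using *(3) nth_perm_list by metis
  next
    case False
    then show ?thesis using sym_subgroupD(1)[OF S] * by (metis permutes_not_in)
  qed
qed

lemma perm_tuple_coord:
  assumes "s \<in> S" "c \<in> {1..a}"
  shows "(perm_list n s, c) \<in> tensor_coords n n a"
  using assms(2) permutes_image[OF sym_subgroupD(1)[OF S assms(1)]]
  by (simp add: tensor_coords_def set_perm_list length_perm_list)

text \<open>The output tensor has order 0 with \<open>([], 1)\<close> as its only coordinate, and
  lists that do not come from \<open>S\<close> carry weight 0.\<close>

lemma affine_part_2:
  "affine_part \<N> 2 X ([], 1) = (\<Sum>s\<in>S. \<Sum>c = 1..a. \<beta> c / card S * X (perm_list n s, c))"
proof -
  let ?m = "perm_list n"
  let ?f = "\<lambda>(is', c'). (if is' \<in> ?m ` S then \<beta> c' / card S else 0) * X (is', c')"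
  have "affine_part \<N> 2 X ([], 1) = (\<Sum>q\<in>tensor_coords n n a. ?f q)"
    using n unfolding affine_part_def symmetrized_network_def
    by (simp add: sym_order_def sym_channels_def max_absorb2 tensor_coords_order0[unfolded One_nat_def] case_prod_unfold)
  also have "\<dots> = (\<Sum>q\<in>?m ` S \<times> {1..a}. ?f q)"
  proof (rule sum.mono_neutral_right)
    show "?m ` S \<times> {1..a} \<subseteq> tensor_coords n n a"
      using perm_tuple_coord by blast
    show "\<forall>q\<in>tensor_coords n n a - ?m ` S \<times> {1..a}. ?f q = 0"
      by (auto simp: tensor_coords_def split: if_splits)
  qed simp
  also have "\<dots> = (\<Sum>is\<in>?m ` S. \<Sum>c = 1..a. \<beta> c / card S * X (is, c))"
    by (subst sum.cartesian_product[symmetric]) (auto intro!: sum.cong)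
  also have "\<dots> = (\<Sum>s\<in>S. \<Sum>c = 1..a. \<beta> c / card S * X (?m s, c))"
    by (subst sum.reindex[OF inj_on_map_perm]) simp
  finally show ?thesis .
qed

text \<open>Since \<open>x (s k)\<close> is the \<open>k\<close>-th coordinate of \<open>x\<close>
  moved by \<open>inv' s\<close>, this is the mean of the shallow network over the images of
  \<open>x\<close> under \<open>S\<close>.\<close>

lemma inv_value_symmetrized:
  "inv_value n \<N> x =
    (\<Sum>s\<in>S. \<Sum>c = 1..a. \<beta> c * relu ((\<Sum>k = 1..n. w c k * x (s k)) + b c)) / card S"
proof -
  have coords: "coords \<N> 2 = tensor_coords n n a" "coords \<N> 3 = {([], 1)}" "depth \<N> = 2"
    using n by (simp_all add: symmetrized_network_def sym_order_def sym_channels_def max_absorb2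
        tensor_coords_order0[unfolded One_nat_def])
  have 1: "run \<N> 1 (vec_tensor n x) (perm_list n s, c)
      = relu ((\<Sum>k = 1..n. w c k * x (s k)) + b c)" if "s \<in> S" "c \<in> {1..a}" for s c
  proof -
    have k: "vec_tensor n x ([perm_list n s ! (k - 1)], 1) = x (s k)" if "k \<in> {1..n}" for k
    proof -
      have "s k \<in> {1..n}"
        using that permutes_in_image[OF sym_subgroupD(1)[OF S \<open>s \<in> S\<close>]] by blast
      then show ?thesis
        by (simp add: nth_perm_list[OF that, unfolded One_nat_def] vec_tensor_def tensor_coords_order1[unfolded One_nat_def])
    qed
    have "run \<N> 1 (vec_tensor n x) (perm_list n s, c)
        = relu (affine_part \<N> 1 (vec_tensor n x) (perm_list n s, c))"
      using perm_tuple_coord[OF that] coords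
      by (simp add: block_def numeral_2_eq_2)
    also have "affine_part \<N> 1 (vec_tensor n x) (perm_list n s, c)
        = (\<Sum>k = 1..n. w c k * x (s k)) + b c"
      unfolding affine_part_1[OF perm_tuple_coord[OF that]]
      by (intro arg_cong2[of _ _ _ _ "(+)"] sum.cong refl) (simp only: k)
    finally show ?thesis .
  qed
  have "inv_value n \<N> x = affine_part \<N> 2 (run \<N> 1 (vec_tensor n x)) ([], 1)"
    using coords by (simp add: inv_value_def represented_def block_def numeral_2_eq_2 numeral_3_eq_3)
  also have "\<dots> = (\<Sum>s\<in>S. \<Sum>c = 1..a. \<beta> c / card S * relu ((\<Sum>k = 1..n. w c k * x (s k)) + b c))"
    unfolding affine_part_2 by (intro sum.cong refl) (simp only: 1)
  finally show ?thesis
    by (simp add: sum_divide_distrib)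
qed

text \<open>In the first affine map, relabelling the tensor index and the input by the same
  permutation selects the same values. In the second, the action replaces \<open>s\<close> by
  \<open>inv' g \<circ> s\<close>, which only reindexes the sum over \<open>S\<close>.\<close>

lemma invariant_symmetrized:
  "invariant_tensor_network n S (sym_order n) (sym_channels a) \<N>"
proof -
  have coords: "coords \<N> r = tensor_coords n (sym_order n r) (sym_channels a r)" "depth \<N> = 2" for r
    by (simp_all add: symmetrized_network_def)
  have order: "sym_order n 1 = 1" "sym_order n 2 = n" "sym_order n 3 = 0"
    "sym_channels a 1 = 1" "sym_channels a 2 = a" "sym_channels a 3 = 1"
    using n by (simp_all add: sym_order_def sym_channels_def)
  have equi: "affine_part \<N> r (tensor_act n (sym_order n r) (sym_channels a r) g X)
      = tensor_act n (sym_order n (r + 1)) (sym_channels a (r + 1)) g (affine_part \<N> r X)"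
    if "r \<in> {1..2}" "g \<in> S" for r g X
  proof
    fix q :: tensor_coord
    obtain "is" c where q: "q = (is, c)" by force
    have g: "inv' g permutes {1..n}" using sym_subgroupD(1,4)[OF S] that by blast
    have "r = 1 \<or> r = 2" using that by auto
    then show "affine_part \<N> r (tensor_act n (sym_order n r) (sym_channels a r) g X) q
      = tensor_act n (sym_order n (r + 1)) (sym_channels a (r + 1)) g (affine_part \<N> r X) q"
    proof (elim disjE)
      assume r: "r = 1"
      show ?thesis
      proof (cases "q \<in> tensor_coords n n a")
        case False
        then show ?thesis
          by (simp add: affine_part_def tensor_act_def coords r order[unfolded One_nat_def] numeral_2_eq_2[symmetric])
      next
        case True
        have *: "tensor_act n 1 1 g X ([is ! (k - 1)], 1) = X ([map (inv' g) is ! (k - 1)], 1)"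
          if "k \<in> {1..n}" for k
        proof -
          have "k - 1 < length is" "is ! (k - 1) \<in> {1..n}"
            using True that nth_mem[of "k - 1" "is"] by (fastforce simp: tensor_coords_def q)+
          then show ?thesis
            unfolding tensor_act_def tensor_coords_order1 by auto
        qed
        have True': "(map (inv' g) is, c) \<in> tensor_coords n n a"
          using True q map_perm_tensor_coords[OF g] by blast
        have "affine_part \<N> 1 (tensor_act n 1 1 g X) (is, c)
            = (\<Sum>k = 1..n. w c k * X ([map (inv' g) is ! (k - 1)], 1)) + b c"
          unfolding affine_part_1[OF True[unfolded q]]
          by (intro arg_cong2[of _ _ _ _ "(+)"] sum.cong refl) (simp only: *)
        also have "\<dots> = affine_part \<N> 1 X (map (inv' g) is, c)"
          by (rule affine_part_1[OF True', symmetric])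
        also have "\<dots> = tensor_act n n a g (affine_part \<N> 1 X) (is, c)"
          using True by (simp add: tensor_act_def q)
        finally show ?thesis by (simp only: r order one_add_one q)
      qed
    next
      assume r: "r = 2"
      show ?thesis
      proof (cases "q = ([], 1)")
        case False
        then show ?thesis
          using tensor_coords_order0[of n]
          by (simp add: affine_part_def tensor_act_def coords r order[unfolded One_nat_def])
      next
        case True
        have *: "tensor_act n n a g X (perm_list n s, c) = X (perm_list n (inv' g \<circ> s), c)"
          if "s \<in> S" "c \<in> {1..a}" for s c
          using perm_tuple_coord[OF that] by (simp add: tensor_act_def map_perm_list)
        have "affine_part \<N> 2 (tensor_act n n a g X) ([], 1)
          = (\<Sum>s\<in>S. \<Sum>c = 1..a. \<beta> c / card S * X (perm_list n (inv' g \<circ> s), c))"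
          unfolding affine_part_2 by (intro sum.cong refl) (simp only: *)
        also have "\<dots> = (\<Sum>s\<in>S. \<Sum>c = 1..a. \<beta> c / card S * X (perm_list n s, c))"
        proof (rule sum.reindex_bij_witness[of _ "\<lambda>s. g \<circ> s" "\<lambda>s. inv' g \<circ> s"])
          fix s assume "s \<in> S"
          then show "inv' g \<circ> s \<in> S" "g \<circ> s \<in> S"
            using sym_subgroupD[OF S] \<open>g \<in> S\<close> by blast+
          show "g \<circ> (inv' g \<circ> s) = s" "inv' g \<circ> (g \<circ> s) = s"
            using permutes_inv_o[OF sym_subgroupD(1)[OF S \<open>g \<in> S\<close>]] by (simp_all add: o_assoc)
        qed simp
        also have "\<dots> = affine_part \<N> 2 X ([], 1)"
          by (rule affine_part_2[symmetric])
        also have "\<dots> = tensor_act n 0 1 g (affine_part \<N> 2 X) ([], 1)"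
          unfolding tensor_act_def tensor_coords_order0 by simp
        finally show ?thesis by (simp add: r order True del: One_nat_def)
      qed
    qed
  qed
  show ?thesis
    unfolding invariant_tensor_network_def well_formed_def
    using equi by (auto simp: coords sym_order_def sym_channels_def)
qed

text \<open>Each term of the mean is the shallow network at a point of \<open>K\<close> where
  \<open>f\<close> takes the value \<open>f x\<close>, so each term is within \<epsilon> of it, and
  so is the mean.\<close>

lemma symmetrized_error:
  assumes K: "\<And>g x. g \<in> S \<Longrightarrow> x \<in> K \<Longrightarrow> perm_act {1..n} g x \<in> K"
    and f: "\<And>g x. g \<in> S \<Longrightarrow> x \<in> K \<Longrightarrow> f (perm_act {1..n} g x) = f x"
    and approx: "\<And>x. x \<in> K \<Longrightarrow> \<bar>f x - (\<Sum>c = 1..a. \<beta> c * relu ((\<Sum>k = 1..n. w c k * x k) + b c))\<bar> \<le> \<epsilon>"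
    and x: "x \<in> K"
  shows "\<bar>f x - inv_value n \<N> x\<bar> \<le> \<epsilon>"
proof -
  define h where "h s = (\<Sum>c = 1..a. \<beta> c * relu ((\<Sum>k = 1..n. w c k * x (s k)) + b c))" for s
  have card: "0 < card S" using sym_subgroupD(2,5)[OF S] by (auto simp: card_gt_0_iff)
  have "\<bar>f x - h s\<bar> \<le> \<epsilon>" if s: "s \<in> S" for s
  proof -
    let ?y = "perm_act {1..n} (inv' s) x"
    note s' = sym_subgroupD(4)[OF S s]
    have "?y k = x (s k)" if "k \<in> {1..n}" for k
      using perm_act_apply[OF sym_subgroupD(1)[OF S s'] that]
      by (simp add: inv_inv_eq[OF permutes_bij[OF sym_subgroupD(1)[OF S s]]])
    then have "h s = (\<Sum>c = 1..a. \<beta> c * relu ((\<Sum>k = 1..n. w c k * ?y k) + b c))"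
      by (simp add: h_def)
    then show ?thesis using approx[OF K[OF s' x]] f[OF s' x] by simp
  qed
  then have "\<bar>\<Sum>s\<in>S. f x - h s\<bar> \<le> (\<Sum>s\<in>S. \<epsilon>)"
    by (intro order_trans[OF sum_abs] sum_mono)
  also have "(\<Sum>s\<in>S. f x - h s) = card S * (f x - (\<Sum>s\<in>S. h s) / card S)"
    using card by (simp add: sum_subtractf field_simps)
  finally have "card S * \<bar>f x - (\<Sum>s\<in>S. h s) / card S\<bar> \<le> card S * \<epsilon>"
    by (simp add: abs_mult)
  then have "\<bar>f x - (\<Sum>s\<in>S. h s) / card S\<bar> \<le> \<epsilon>" using card by simp
  then show ?thesis by (simp add: inv_value_symmetrized h_def)
qed

end

section \<open>The stacked network\<close>

lemma carrier_perm_group [simp]: "carrier (perm_group n G) = G"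
  by (simp add: perm_group_def)

lemma group_perm_group:
  assumes "subgroup G (sym_group n)"
  shows "group (perm_group n G)"
  unfolding perm_group_def by (rule group.subgroup_imp_group[OF sym_group_is_group assms])

lemma Stab_iff: "g \<in> Stab n G i \<longleftrightarrow> g \<in> G \<and> g i = i"
  by (simp add: Stab_def stabilizer_def)

lemma subgroup_Stab:
  assumes "subgroup G (sym_group n)"
  shows "subgroup (Stab n G i) (sym_group n)"
proof (rule group.subgroupI[OF sym_group_is_group])
  note G = sym_subgroupD[OF assms]
  show "Stab n G i \<subseteq> carrier (sym_group n)"
    using G(1) by (auto simp: Stab_iff sym_group_carrier)
  show "Stab n G i \<noteq> {}"
  proof -
    have "id \<in> Stab n G i" using G(2) by (simp add: Stab_iff)
    then show ?thesis by blast
  qed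
  show "inv\<^bsub>sym_group n\<^esub> g \<in> Stab n G i" if "g \<in> Stab n G i" for g
  proof -
    have g: "g \<in> G" "g i = i" using that by (simp_all add: Stab_iff)
    then show ?thesis
      using G(4)[OF g(1)] permutes_inverses(2)[OF G(1)[OF g(1)], of i]
        sym_group_inv_equality[of g n] subgroup.mem_carrier[OF assms g(1)]
      by (simp add: Stab_iff)
  qed
  show "g \<otimes>\<^bsub>sym_group n\<^esub> h \<in> Stab n G i" if "g \<in> Stab n G i" "h \<in> Stab n G i" for g h
    using that G(3)[of g h] by (simp add: Stab_iff sym_group_mult)
qed

text \<open>Restricting each \<open>\<phi> g\<close> to \<open>I\<close> gives the extensional
  bijections that form \<open>BijGroup I\<close>. The inverse of \<open>\<phi> g\<close> on
  \<open>I\<close> is \<open>\<phi> (inv' g)\<close>, which identifies the pullback formula for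
  \<open>A\<close> with \<open>perm_act\<close>.\<close>

lemma layer_actionI:
  assumes G: "subgroup G (sym_group n)"
    and closed: "\<And>g u. g \<in> G \<Longrightarrow> u \<in> I \<Longrightarrow> \<phi> g u \<in> I"
    and one: "\<And>u. u \<in> I \<Longrightarrow> \<phi> id u = u"
    and mult: "\<And>g h u. g \<in> G \<Longrightarrow> h \<in> G \<Longrightarrow> u \<in> I \<Longrightarrow> \<phi> (g \<circ> h) u = \<phi> g (\<phi> h u)"
    and faithful: "\<And>g h. g \<in> G \<Longrightarrow> h \<in> G \<Longrightarrow> (\<And>u. u \<in> I \<Longrightarrow> \<phi> g u = \<phi> h u) \<Longrightarrow> g = h"
    and A: "\<And>g x. g \<in> G \<Longrightarrow> A g x = (\<lambda>u\<in>I. x (\<phi> (inv' g) u))"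
  shows "layer_action (perm_group n G) I A"
proof -
  note sub = sym_subgroupD[OF G]
  let ?\<phi> = "\<lambda>g. restrict (\<phi> g) I"
  have inv: "\<phi> (inv' g) (\<phi> g u) = u" "\<phi> g (\<phi> (inv' g) u) = u" if "g \<in> G" "u \<in> I" for g u
    using mult[of "inv' g" g u] mult[of g "inv' g" u] one that sub(4) permutes_inv_o[OF sub(1)]
    by auto
  have bij: "bij_betw (\<phi> g) I I" if "g \<in> G" for g
    by (rule bij_betwI[where g = "\<phi> (inv' g)"]) (use that closed sub(4) inv in auto)
  have Bij: "?\<phi> g \<in> Bij I" if "g \<in> G" for g
    using bij[OF that] by (simp add: Bij_def)
  have "group_hom (perm_group n G) (BijGroup I) ?\<phi>"
  proof (intro group_hom.intro group_hom_axioms.intro group_perm_group[OF G] group_BijGroup homI)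
    show "?\<phi> g \<in> carrier (BijGroup I)" if "g \<in> carrier (perm_group n G)" for g
      using Bij that by (simp add: BijGroup_def)
    show "?\<phi> (g \<otimes>\<^bsub>perm_group n G\<^esub> h) = ?\<phi> g \<otimes>\<^bsub>BijGroup I\<^esub> ?\<phi> h"
      if "g \<in> carrier (perm_group n G)" "h \<in> carrier (perm_group n G)" for g h
      using that Bij closed mult
      by (auto simp: BijGroup_def perm_group_def sym_group_mult compose_def fun_eq_iff)
  qed
  moreover have "inj_on ?\<phi> G"
  proof (rule inj_onI)
    fix g h assume gh: "g \<in> G" "h \<in> G" "?\<phi> g = ?\<phi> h"
    have "\<phi> g u = \<phi> h u" if "u \<in> I" for u
      using fun_cong[OF gh(3), of u] that by simp
    then show "g = h" using faithful gh(1,2) by blast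
  qed
  moreover have "A g x = perm_act I (?\<phi> g) x" if "g \<in> G" for g x
  proof -
    have "inv_into I (?\<phi> g) u = \<phi> (inv' g) u" if "u \<in> I" for u
      using inv_into_f_f[of "?\<phi> g" I "\<phi> (inv' g) u"] bij[OF \<open>g \<in> G\<close>]
        closed[OF sub(4)[OF \<open>g \<in> G\<close>] that] inv[OF \<open>g \<in> G\<close> that]
      by (simp add: bij_betw_def)
    then show ?thesis
      unfolding A[OF that] perm_act_def by (intro restrict_ext) simp
  qed
  ultimately show ?thesis
    unfolding layer_action_def faithful_action_def faithful_action_axioms_def group_action_def
    by (intro exI[of _ ?\<phi>]) simp
qed

section \<open>Orbits as consecutive intervals, and the twisting elements\<close>

lemma orb_start_Suc: "1 \<le> j \<Longrightarrow> orb_start l (Suc j) = orb_start l j + l j"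
  by (simp add: orb_start_def)

lemma orb_start_less:
  assumes "1 \<le> i" "i < j"
  shows "orb_start l i + l i \<le> orb_start l j"
  using assms(2)
proof (induction j)
  case (Suc j)
  then show ?case using assms(1) by (cases "i = j") (auto simp: orb_start_Suc)
qed simp

text \<open>The intervals are pairwise disjoint by \<open>orb_start_less\<close>, so the description
  in \<open>locate\<close> has exactly one solution.\<close>

lemma locate_eq:
  assumes "j \<in> {1..m}" "k \<in> {1..l j}"
  shows "locate m l (orb_start l j + k - 1) = (j, k)"
  unfolding locate_def
proof (rule the_equality)
  fix jk
  assume *: "case jk of (j', k') \<Rightarrow> j' \<in> {1..m} \<and> k' \<in> {1..l j'} \<and>
    orb_start l j + k - 1 = orb_start l j' + k' - 1"
  obtain j' k' where jk: "jk = (j', k')" by force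
  have "j' = j"
    using * assms orb_start_less[of j j' l] orb_start_less[of j' j l] jk
    by (cases j j' rule: linorder_cases) auto
  then show "jk = (j, k)" using * assms jk by auto
qed (use assms in auto)

locale orbit_setting =
  fixes n m :: nat and G :: "(nat \<Rightarrow> nat) set" and l :: "nat \<Rightarrow> nat"
    and \<tau> :: "nat \<Rightarrow> nat \<Rightarrow> nat \<Rightarrow> nat"
  assumes G: "subgroup G (sym_group n)" and data: "orbit_data n G m l \<tau>"
begin

lemmas G_simps = sym_subgroupD[OF G]

text \<open>A position \<open>p = i\<^sub>j + k - 1\<close> has \<open>ind p = j\<close> and \<open>rep p = \<tau>\<^sub>j\<^sub>,\<^sub>k\<close>.\<close>

definition ind :: "nat \<Rightarrow> nat" where
  "ind p = fst (locate m l p)"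

definition rep :: "nat \<Rightarrow> nat \<Rightarrow> nat" where
  "rep p = (case locate m l p of (j, k) \<Rightarrow> \<tau> j k)"

lemma orbit_dataD:
  assumes "j \<in> {1..m}"
  shows "orbit (perm_group n G) (\<lambda>\<sigma>. \<sigma>) (orb_start l j) = {orb_start l j..<orb_start l j + l j}"
    and "k \<in> {1..l j} \<Longrightarrow> \<tau> j k \<in> G"
    and "k \<in> {1..l j} \<Longrightarrow> inv' (\<tau> j k) (orb_start l j) = orb_start l j + k - 1"
  using bspec[OF conjunct2[OF data[unfolded orbit_data_def]] assms] by simp_all

lemma union_orbits: "{1..n} = (\<Union>j\<in>{1..m}. {orb_start l j..<orb_start l j + l j})"
proof -
  have "{1..n} = (\<Union>j\<in>{1..m}. orbit (perm_group n G) (\<lambda>\<sigma>. \<sigma>) (orb_start l j))"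
    by (rule conjunct1[OF data[unfolded orbit_data_def]])
  also have "\<dots> = (\<Union>j\<in>{1..m}. {orb_start l j..<orb_start l j + l j})"
    by (intro SUP_cong refl orbit_dataD)
  finally show ?thesis .
qed

lemma position_in:
  assumes "j \<in> {1..m}" "k \<in> {1..l j}"
  shows "orb_start l j + k - 1 \<in> {1..n}"
  unfolding union_orbits using assms by (intro UN_I[of j]) auto

lemma position_cases:
  assumes "p \<in> {1..n}"
  obtains j k where "j \<in> {1..m}" "k \<in> {1..l j}" "p = orb_start l j + k - 1"
proof -
  obtain j where j: "j \<in> {1..m}" "p \<in> {orb_start l j..<orb_start l j + l j}"
    using assms union_orbits by blast
  show ?thesis by (rule that[of j "p + 1 - orb_start l j"]) (use j in auto)
qed

lemma position:
  assumes "j \<in> {1..m}" "k \<in> {1..l j}"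
  shows "ind (orb_start l j + k - 1) = j" "rep (orb_start l j + k - 1) = \<tau> j k"
  using locate_eq[of j m k l] assms by (simp_all add: ind_def rep_def)

lemma
  assumes "p \<in> {1..n}"
  shows ind_in: "ind p \<in> {1..m}" and rep_in: "rep p \<in> G"
    and inv_rep: "inv' (rep p) (orb_start l (ind p)) = p"
proof -
  obtain j k where jk: "j \<in> {1..m}" "k \<in> {1..l j}" "p = orb_start l j + k - 1"
    using position_cases[OF assms] .
  then have "ind p = j" "rep p = \<tau> j k" using position[of j k] by simp_all
  then show "ind p \<in> {1..m}" "rep p \<in> G" "inv' (rep p) (orb_start l (ind p)) = p"
    using jk orbit_dataD(2,3)[of j k] by simp_all
qed

lemma rep_self:
  assumes "p \<in> {1..n}"
  shows "rep p p = orb_start l (ind p)"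
  using inv_rep[OF assms]
    permutes_inverses(1)[OF G_simps(1)[OF rep_in[OF assms]], of "orb_start l (ind p)"] by simp

text \<open>Writing \<open>p\<close> as the image of the orbit start under
  \<open>inv' (rep p)\<close> places \<open>\<sigma> p\<close> in the same orbit, hence in the same
  interval.\<close>

lemma ind_act:
  assumes "\<sigma> \<in> G" "p \<in> {1..n}"
  shows "ind (\<sigma> p) = ind p"
proof -
  let ?s = "orb_start l (ind p)"
  have "\<sigma> p = (\<sigma> \<circ> inv' (rep p)) ?s" using inv_rep[OF assms(2)] by simp
  moreover have "\<sigma> \<circ> inv' (rep p) \<in> G" using assms G_simps rep_in by blast
  ultimately have "\<sigma> p \<in> orbit (perm_group n G) (\<lambda>\<sigma>. \<sigma>) ?s" unfolding orbit_def
    by (intro CollectI exI[of _ "\<sigma> \<circ> inv' (rep p)"]) simp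
  then have *: "\<sigma> p \<in> {?s..<?s + l (ind p)}" using orbit_dataD(1)[OF ind_in[OF assms(2)]] by simp
  then have "\<sigma> p = ?s + (\<sigma> p + 1 - ?s) - 1" "\<sigma> p + 1 - ?s \<in> {1..l (ind p)}" by auto
  then show ?thesis
    using position(1)[of "ind p" "\<sigma> p + 1 - ?s"] ind_in[OF assms(2)] by simp
qed

lemma act_in: "\<sigma> \<in> G \<Longrightarrow> \<sigma> p \<in> {1..n} \<longleftrightarrow> p \<in> {1..n}"
  using permutes_in_image[OF G_simps(1)] .

lemma inv_act [simp]: "\<sigma> \<in> G \<Longrightarrow> inv' \<sigma> (\<sigma> p) = p" "\<sigma> \<in> G \<Longrightarrow> \<sigma> (inv' \<sigma> p) = p"
  using permutes_inverses[OF G_simps(1)] by auto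

text \<open>The product of \<open>inv' (rep (inv' \<sigma> p))\<close>, \<sigma> and
  \<open>rep p\<close> carries the orbit start first to \<open>inv' \<sigma> p\<close>, then to
  \<open>p\<close>, then back, so it lies in the stabilizer. Conversely, fixing the orbit start
  determines the second representative.\<close>

lemma twist_eq:
  assumes "\<sigma> \<in> G" "p \<in> {1..n}"
  shows "twist n G m l \<tau> \<sigma> p = rep p \<circ> \<sigma> \<circ> inv' (rep (inv' \<sigma> p))"
    and "twist n G m l \<tau> \<sigma> p \<in> Stab n G (orb_start l (ind p))"
proof -
  obtain j k where jk: "j \<in> {1..m}" "k \<in> {1..l j}" "p = orb_start l j + k - 1"
    using position_cases[OF assms(2)] .
  let ?p = "inv' \<sigma> p" and ?s = "orb_start l j"
  have p: "?p \<in> {1..n}" using assms act_in[OF G_simps(4)] by blast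
  have j: "ind p = j" and rp: "rep p = \<tau> j k" using position[of j k] jk by simp_all
  have j': "ind ?p = j" using ind_act[OF G_simps(4)[OF assms(1)] assms(2)] j by simp
  obtain j1 k' where "j1 \<in> {1..m}" "k' \<in> {1..l j1}" "?p = orb_start l j1 + k' - 1"
    using position_cases[OF p] .
  moreover from this have "j1 = j" using position(1)[of j1 k'] j' by simp
  ultimately have k': "k' \<in> {1..l j}" "?p = orb_start l j + k' - 1" "rep ?p = \<tau> j k'"
    using position(2)[of j k'] jk(1) by simp_all
  let ?\<rho> = "rep p \<circ> \<sigma> \<circ> inv' (rep ?p)"
  have stab: "?\<rho> \<in> Stab n G ?s"
    using G_simps(3,4) rep_in assms p inv_rep[OF p] rep_self[OF assms(2)] j j'
    by (simp add: Stab_iff)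
  have "twist n G m l \<tau> \<sigma> p
    = (THE \<rho>. \<rho> \<in> Stab n G ?s \<and> (\<exists>k'\<in>{1..l j}. \<rho> = \<tau> j k \<circ> \<sigma> \<circ> inv' (\<tau> j k')))"
    unfolding twist_def jk(3) locate_eq[of j m k l, OF jk(1,2)] by simp
  also have "\<dots> = ?\<rho>"
  proof (rule the_equality)
    show "?\<rho> \<in> Stab n G ?s \<and> (\<exists>k'\<in>{1..l j}. ?\<rho> = \<tau> j k \<circ> \<sigma> \<circ> inv' (\<tau> j k'))"
      using stab k' rp by auto
    fix \<rho>
    assume "\<rho> \<in> Stab n G ?s \<and> (\<exists>k'\<in>{1..l j}. \<rho> = \<tau> j k \<circ> \<sigma> \<circ> inv' (\<tau> j k'))"
    then obtain k2 where k2: "\<rho> ?s = ?s" "k2 \<in> {1..l j}" "\<rho> = \<tau> j k \<circ> \<sigma> \<circ> inv' (\<tau> j k2)"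
      by (auto simp: Stab_iff)
    \<comment> \<open>Evaluating \<rho> at its fixed point shows that \<sigma> maps position
      \<open>k2\<close> of the orbit to \<open>p\<close>; hence that position is
      \<open>inv' \<sigma> p\<close>.\<close>
    have "rep p (\<sigma> (?s + k2 - 1)) = rep p p"
      using k2 orbit_dataD(3)[of j k2] jk(1) rep_self[OF assms(2)] j rp by simp
    then have "inv' (rep p) (rep p (\<sigma> (?s + k2 - 1))) = inv' (rep p) (rep p p)" by simp
    then have "inv' \<sigma> (\<sigma> (?s + k2 - 1)) = ?p"
      by (simp only: inv_act[OF rep_in[OF assms(2)]])
    then have "?s + k2 - 1 = ?p" by (simp only: inv_act[OF assms(1)])
    then have "\<tau> j k2 = rep ?p" using position(2)[of j k2] jk(1) k2(2) by simp
    then show "\<rho> = ?\<rho>" using k2(3) rp by simp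
  qed
  finally show "twist n G m l \<tau> \<sigma> p = ?\<rho>" .
  with stab j show "twist n G m l \<tau> \<sigma> p \<in> Stab n G (orb_start l (ind p))" by simp
qed

lemma twist_in: "\<sigma> \<in> G \<Longrightarrow> p \<in> {1..n} \<Longrightarrow> twist n G m l \<tau> \<sigma> p \<in> G"
  using twist_eq(2) Stab_iff by blast

lemma inv_twist:
  assumes "\<sigma> \<in> G" "p \<in> {1..n}"
  shows "inv' (twist n G m l \<tau> \<sigma> p) = rep (inv' \<sigma> p) \<circ> inv' \<sigma> \<circ> inv' (rep p)"
proof (rule inv_unique_comp)
  have p: "inv' \<sigma> p \<in> {1..n}" using assms act_in[OF G_simps(4)] by blast
  note [simp] = rep_in[OF assms(2)] rep_in[OF p] assms(1)
  show "twist n G m l \<tau> \<sigma> p \<circ> (rep (inv' \<sigma> p) \<circ> inv' \<sigma> \<circ> inv' (rep p)) = id"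
    by (simp add: twist_eq[OF assms] fun_eq_iff)
  show "rep (inv' \<sigma> p) \<circ> inv' \<sigma> \<circ> inv' (rep p) \<circ> twist n G m l \<tau> \<sigma> p = id"
    by (simp add: twist_eq[OF assms] fun_eq_iff)
qed

end

section \<open>Faithful actions on the vector layers and on the hidden layers\<close>

context orbit_setting
begin

lemma perm_act_G:
  "\<sigma> \<in> G \<Longrightarrow> i \<in> {Suc 0..n} \<Longrightarrow> perm_act {Suc 0..n} \<sigma> x i = x (inv' \<sigma> i)"
  using perm_act_apply[OF G_simps(1), of \<sigma> i x] by simp

lemma layer_action_vec:
  "layer_action (perm_group n G) (Inl ` {1..n})
     (\<lambda>\<sigma> X. to_layer n (perm_act {1..n} \<sigma> (from_layer n X)))"
proof (rule layer_actionI[OF G, where \<phi> = "\<lambda>\<sigma> u. Inl (\<sigma> (projl u))"])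
  show "g = h" if "g \<in> G" "h \<in> G"
    "\<And>u. u \<in> Inl ` {1..n} \<Longrightarrow> (Inl (g (projl u)) :: stack_coord) = Inl (h (projl u))" for g h
  proof
    fix i
    show "g i = h i"
    proof (cases "i \<in> {1..n}")
      case True
      then show ?thesis using that(3)[of "Inl i"] by simp
    next
      case False
      then show ?thesis
        using permutes_not_in[OF G_simps(1)[OF that(1)]] permutes_not_in[OF G_simps(1)[OF that(2)]] by simp
    qed
  qed
  show "to_layer n (perm_act {1..n} g (from_layer n X))
      = (\<lambda>u\<in>Inl ` {1..n}. X (Inl (inv' g (projl u))))" if "g \<in> G" for g X
    unfolding to_layer_def
  proof (rule restrict_ext)
    fix u :: stack_coord assume "u \<in> Inl ` {1..n}"
    then obtain i where "u = Inl i" "i \<in> {1..n}" by blast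
    moreover from this have "inv' g i \<in> {1..n}" using act_in[OF G_simps(4)] that by blast
    ultimately show "perm_act {1..n} g (from_layer n X) (projl u) = X (Inl (inv' g (projl u)))"
      using perm_act_G[OF that] by (simp add: from_layer_def)
  qed
  show "Inl (g (projl u)) \<in> Inl ` {1..n}" if "g \<in> G" "u \<in> Inl ` {1..n}"
    for g and u :: stack_coord
    using that(2) act_in[OF that(1)] by fastforce
qed auto

text \<open>A coordinate moves from block \<open>p\<close> to block \<open>\<sigma> p\<close> while
  its tensor index is moved by the twist at the target \<open>\<sigma> p\<close>. Since
  \<open>1 \<le> a\<close> puts a coordinate in every block, \<sigma> can be recovered from the
  movement of the blocks.\<close>

lemma layer_action_hidden:
  assumes "1 \<le> a"
  shows "layer_action (perm_group n G) (Inr ` ({1..n} \<times> tensor_coords n d a))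
     (hidden_act n G m l \<tau> d a)"
proof -
  let ?I = "Inr ` ({1..n} \<times> tensor_coords n d a) :: stack_coord set"
  let ?\<phi> = "\<lambda>\<sigma> u :: stack_coord. (case projr u of (p, (is, c)) \<Rightarrow>
    Inr (\<sigma> p, (map (twist n G m l \<tau> \<sigma> (\<sigma> p)) is, c))) :: stack_coord"
  have twist: "twist n G m l \<tau> \<sigma> (\<sigma> p) = rep (\<sigma> p) \<circ> \<sigma> \<circ> inv' (rep p)"
    if "\<sigma> \<in> G" "p \<in> {1..n}" for \<sigma> p
    using twist_eq(1)[of \<sigma> "\<sigma> p"] that act_in[OF that(1), of p] by simp
  have I_cases: thesis
    if "u \<in> ?I" "\<And>p is c. u = Inr (p, (is, c)) \<Longrightarrow> p \<in> {1..n} \<Longrightarrow> (is, c) \<in> tensor_coords n d a \<Longrightarrow> thesis"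
    for u thesis
    using that by auto
  show ?thesis
  proof (rule layer_actionI[OF G, where \<phi> = ?\<phi>])
    show "?\<phi> g u \<in> ?I" if "g \<in> G" "u \<in> ?I" for g u
    proof (rule I_cases[OF that(2)])
      fix p "is" c assume u: "u = Inr (p, (is, c))" "p \<in> {1..n}" "(is, c) \<in> tensor_coords n d a"
      then have "g p \<in> {1..n}" using act_in[OF that(1)] by blast
      with u show ?thesis
        using map_perm_tensor_coords[OF G_simps(1)[OF twist_in[OF that(1)]]] by simp
    qed
    show "?\<phi> id u = u" if "u \<in> ?I" for u
      by (rule I_cases[OF that]) (simp add: twist[OF G_simps(2), simplified] permutes_inv_o[OF G_simps(1)[OF rep_in]])
    show "?\<phi> (g \<circ> h) u = ?\<phi> g (?\<phi> h u)" if gh: "g \<in> G" "h \<in> G" and "u \<in> ?I" for g h u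
    proof (rule I_cases[OF that(3)])
      fix p "is" c assume u: "u = Inr (p, (is, c))" "p \<in> {1..n}"
      have hp: "h p \<in> {1..n}" using act_in[OF gh(2)] u by blast
      \<comment> \<open>Cocycle identity: the intermediate representative \<open>rep (h p)\<close>
        cancels.\<close>
      have "twist n G m l \<tau> (g \<circ> h) (g (h p)) = twist n G m l \<tau> g (g (h p)) \<circ> twist n G m l \<tau> h (h p)"
        using twist[OF G_simps(3)[OF gh] u(2)] twist[OF gh(1) hp] twist[OF gh(2) u(2)] rep_in[OF hp]
        by (simp add: fun_eq_iff)
      then show ?thesis by (simp add: u)
    qed
    show "g = h" if "g \<in> G" "h \<in> G" "\<And>u. u \<in> ?I \<Longrightarrow> ?\<phi> g u = ?\<phi> h u" for g h
    proof
      fix i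
      show "g i = h i"
      proof (cases "i \<in> {1..n}")
        case True
        then have "(replicate d i, 1) \<in> tensor_coords n d a"
          using assms by (auto simp: tensor_coords_def)
        then show ?thesis using that(3)[of "Inr (i, (replicate d i, 1))"] True by simp
      next
        case False
        then show ?thesis
          using permutes_not_in[OF G_simps(1)[OF that(1)]] permutes_not_in[OF G_simps(1)[OF that(2)]] by simp
      qed
    qed
    show "hidden_act n G m l \<tau> d a g X = (\<lambda>u\<in>?I. X (?\<phi> (inv' g) u))" if g: "g \<in> G" for g X
      unfolding hidden_act_def
    proof (rule restrict_ext)
      fix u assume "u \<in> ?I"
      then show "(case projr u of (p, q) \<Rightarrow>
          tensor_act n d a (twist n G m l \<tau> g p) (\<lambda>q'. X (Inr (inv' g p, q'))) q) = X (?\<phi> (inv' g) u)"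
      proof (rule I_cases)
        fix p "is" c assume u: "u = Inr (p, (is, c))" "p \<in> {1..n}" "(is, c) \<in> tensor_coords n d a"
        \<comment> \<open>\<open>hidden_act\<close> uses the inverse of the twist, whereas the
          pullback along \<open>?\<phi> (inv' g)\<close> uses the twist of the inverse; the two
          coincide.\<close>
        have "twist n G m l \<tau> (inv' g) (inv' g p) = inv' (twist n G m l \<tau> g p)"
          unfolding twist[OF G_simps(4)[OF g] u(2)] inv_twist[OF g u(2)] ..
        then show ?thesis using u by (simp add: tensor_act_def)
      qed
    qed
  qed
qed

end

section \<open>Equivariance and values of the stack of invariant networks\<close>

locale stacked_networks = orbit_setting +
  fixes H :: nat and d a :: "nat \<Rightarrow> nat" and N :: "nat \<Rightarrow> tensor_coord relu_network"
  assumes depth: "\<And>j. j \<in> {1..m} \<Longrightarrow> depth (N j) = H"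
    and invariant: "\<And>j. j \<in> {1..m} \<Longrightarrow> invariant_tensor_network n (Stab n G (orb_start l j)) d a (N j)"
    and H: "1 \<le> H" and d1: "d 1 = 1" and a1: "a 1 = 1"
begin

abbreviation "E \<equiv> stack_network n m l \<tau> H d a N"

abbreviation "net p \<equiv> N (ind p)"

text \<open>The part of the layer \<open>r\<close> of the stack that the \<open>p\<close>-th component reads, in the coordinates of
  \<open>net p\<close>; on the input layer it includes the permutation \<open>rep p\<close>.\<close>

definition slice :: "nat \<Rightarrow> nat \<Rightarrow> (stack_coord \<Rightarrow> real) \<Rightarrow> tensor_coord \<Rightarrow> real" where
  "slice r p X = (if r = 1 then vec_tensor n (perm_act {1..n} (rep p) (from_layer n X))
     else (\<lambda>q\<in>tensor_coords n (d r) (a r). X (Inr (p, q))))"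

lemma depth_E: "depth E = H"
  by (simp add: stack_network_def Let_def)

lemma coords_E:
  "coords E r = (if r = 1 \<or> r = H + 1 then Inl ` {1..n} else Inr ` ({1..n} \<times> tensor_coords n (d r) (a r)))"
  by (simp add: stack_network_def Let_def)

lemma coords_N: "j \<in> {1..m} \<Longrightarrow> r \<in> {1..H + 1} \<Longrightarrow> coords (N j) r = tensor_coords n (d r) (a r)"
  using invariant[of j] depth[of j] unfolding invariant_tensor_network_def by auto

lemma coords_net: "p \<in> {1..n} \<Longrightarrow> r \<in> {1..H + 1} \<Longrightarrow> coords (net p) r = tensor_coords n (d r) (a r)"
  using coords_N ind_in by blast

text \<open>The weights into an output coordinate are written as sums of weights into coordinates
  \<open>Inr (p, q)\<close>, which the output layer itself does not contain. Hidden and last blocks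
  can then share \<open>weighted_sum_E\<close>.\<close>

lemma weight_E:
  "weight E r (Inr (p, q)) (Inl i) = weight (net p) r q ([rep p i], 1)"
  "weight E r (Inr (p, q)) (Inr (p', q')) = (if p = p' then weight (net p) r q q' else 0)"
  "weight E r (Inl p) u = (\<Sum>q\<in>coords (net p) (H + 1). weight E r (Inr (p, q)) u)"
  "bias E r (Inr (p, q)) = bias (net p) r q"
  "bias E r (Inl p) = (\<Sum>q\<in>coords (net p) (H + 1). bias (net p) r q)"
  by (auto simp: stack_network_def Let_def ind_def rep_def split: sum.split)

text \<open>On the input layer a change of variables moves \<open>rep p\<close> from the weights to
  the vector; on a hidden layer the weights are block diagonal and only block \<open>p\<close>
  contributes.\<close>

lemma weighted_sum_E:
  assumes r: "r \<in> {1..H}" and p: "p \<in> {1..n}"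
  shows "(\<Sum>u\<in>coords E r. weight E r (Inr (p, q)) u * X u)
    = (\<Sum>q'\<in>coords (net p) r. weight (net p) r q q' * slice r p X q')"
proof (cases "r = 1")
  case True
  have "(\<Sum>u\<in>coords E r. weight E r (Inr (p, q)) u * X u)
    = (\<Sum>i = 1..n. weight (net p) 1 q ([rep p i], 1) * X (Inl i))"
    by (simp add: coords_E True sum.reindex weight_E)
  also have "\<dots> = (\<Sum>i = 1..n. weight (net p) 1 q ([i], 1) * X (Inl (inv' (rep p) i)))"
    by (rule sum.reindex_bij_witness[of _ "inv' (rep p)" "rep p"])
      (use act_in[OF rep_in[OF p]] act_in[OF G_simps(4)[OF rep_in[OF p]]] rep_in[OF p] in auto)
  also have "\<dots> = (\<Sum>i = 1..n. weight (net p) 1 q ([i], 1) * slice 1 p X ([i], 1))"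
  proof (intro sum.cong refl arg_cong2[of _ _ _ _ "(*)"])
    fix i assume i: "i \<in> {1..n}"
    then have "inv' (rep p) i \<in> {1..n}" using act_in[OF G_simps(4)[OF rep_in[OF p]]] by blast
    then show "X (Inl (inv' (rep p) i)) = slice 1 p X ([i], 1)"
      using i by (simp add: slice_def vec_tensor_def tensor_coords_order1[unfolded One_nat_def]
          perm_act_G[OF rep_in[OF p]] from_layer_def)
  qed
  also have "\<dots> = (\<Sum>q'\<in>tensor_coords n 1 1. weight (net p) r q q' * slice r p X q')"
    unfolding tensor_coords_order1 True by (subst sum.reindex) (auto simp: inj_on_def)
  finally show ?thesis using coords_net[OF p, of r] H d1 a1 by (simp add: True)
next
  case False
  let ?T = "tensor_coords n (d r) (a r)"
  have "(\<Sum>u\<in>coords E r. weight E r (Inr (p, q)) u * X u)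
    = (\<Sum>(p', q')\<in>{1..n} \<times> ?T. (if p = p' then weight (net p) r q q' else 0) * X (Inr (p', q')))"
    using False r by (auto simp: coords_E sum.reindex weight_E intro!: sum.cong)
  also have "\<dots> = (\<Sum>p'\<in>{1..n}. \<Sum>q'\<in>?T. (if p = p' then weight (net p) r q q' else 0) * X (Inr (p', q')))"
    by (rule sum.cartesian_product[symmetric])
  also have "\<dots> = (\<Sum>p'\<in>{1..n}. if p = p' then \<Sum>q'\<in>?T. weight (net p) r q q' * X (Inr (p', q')) else 0)"
    by (intro sum.cong) auto
  also have "\<dots> = (\<Sum>q'\<in>?T. weight (net p) r q q' * X (Inr (p, q')))"
    using p by simp
  also have "\<dots> = (\<Sum>q'\<in>?T. weight (net p) r q q' * slice r p X q')"
    using False by (intro sum.cong) (auto simp: slice_def)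
  finally show ?thesis using coords_net[OF p, of r] r by simp
qed

lemma affine_part_E_hidden:
  assumes "r \<in> {1..<H}" "p \<in> {1..n}" "q \<in> tensor_coords n (d (r + 1)) (a (r + 1))"
  shows "affine_part E r X (Inr (p, q)) = affine_part (net p) r (slice r p X) q"
proof -
  have "Inr (p, q) \<in> coords E (r + 1)" "q \<in> coords (net p) (r + 1)"
    using assms coords_net[of p "r + 1"] by (auto simp: coords_E)
  then show ?thesis
    using weighted_sum_E[of r p q X] assms(1,2) by (simp add: affine_part_def weight_E(4))
qed

text \<open>By linearity the final summation of entries can be carried out on the weights and
  biases.\<close>

lemma affine_part_E_output:
  assumes "p \<in> {1..n}"
  shows "affine_part E H X (Inl p)
    = (\<Sum>q\<in>coords (net p) (H + 1). affine_part (net p) H (slice H p X) q)"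
proof -
  have "Inl p \<in> coords E (H + 1)" using assms by (simp add: coords_E)
  then have "affine_part E H X (Inl p)
    = (\<Sum>u\<in>coords E H. (\<Sum>q\<in>coords (net p) (H + 1). weight E H (Inr (p, q)) u) * X u) + bias E H (Inl p)"
    by (simp add: affine_part_def weight_E(3))
  also have "(\<Sum>u\<in>coords E H. (\<Sum>q\<in>coords (net p) (H + 1). weight E H (Inr (p, q)) u) * X u)
    = (\<Sum>q\<in>coords (net p) (H + 1). \<Sum>u\<in>coords E H. weight E H (Inr (p, q)) u * X u)"
    unfolding sum_distrib_right by (rule sum.swap)
  finally show ?thesis
    using weighted_sum_E[of H p _ X] H assms by (simp add: affine_part_def weight_E(5) sum.distrib)
qed

lemma slice_vecs:
  assumes "r \<in> {1..H}" "p \<in> {1..n}"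
  shows "slice r p X \<in> vecs (coords (net p) r)"
  using coords_net[of p r] assms d1 a1
  by (auto simp: slice_def vecs_def vec_tensor_def)

text \<open>On hidden layers this unfolds the action. On the input layer it is the identity
  \<open>rep p \<circ> \<sigma> = twist \<circ> rep (inv' \<sigma> p)\<close>, with the twist of
  \<sigma> at \<open>p\<close>.\<close>

lemma slice_act:
  assumes r: "r \<in> {1..H}" and \<sigma>: "\<sigma> \<in> G" and p: "p \<in> {1..n}"
  shows "slice r p (stack_action n G m l \<tau> H d a r \<sigma> X)
    = tensor_act n (d r) (a r) (twist n G m l \<tau> \<sigma> p) (slice r (inv' \<sigma> p) X)"
proof -
  let ?p = "inv' \<sigma> p" and ?t = "twist n G m l \<tau> \<sigma> p"
  have p': "?p \<in> {1..n}" using act_in[OF G_simps(4)[OF \<sigma>]] p by blast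
  have t: "inv' ?t \<in> G" using twist_in[OF \<sigma> p] G_simps(4) by blast
  show ?thesis
  proof (cases "r = 1")
    case True
    show ?thesis
    proof
      fix q
      show "slice r p (stack_action n G m l \<tau> H d a r \<sigma> X) q
        = tensor_act n (d r) (a r) ?t (slice r ?p X) q"
      proof (cases "q \<in> tensor_coords n 1 1")
        case False
        then show ?thesis using d1 a1 by (simp add: True slice_def tensor_act_def vec_tensor_def)
      next
        case q: True
        then obtain i where i: "q = ([i], 1)" "i \<in> {1..n}"
          unfolding tensor_coords_order1 by blast
        note in_G = act_in[OF G_simps(4)[OF rep_in[OF p]], of i]
          act_in[OF G_simps(4)[OF \<sigma>], of "inv' (rep p) i"] act_in[OF t, of i]
        have "slice r p (stack_action n G m l \<tau> H d a r \<sigma> X) q = from_layer n X (inv' \<sigma> (inv' (rep p) i))"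
          using i q in_G True perm_act_G[OF rep_in[OF p]] perm_act_G[OF \<sigma>]
          by (simp add: slice_def stack_action_def vec_tensor_def from_layer_def to_layer_def)
        also have "\<dots> = tensor_act n 1 1 ?t (vec_tensor n (perm_act {1..n} (rep ?p) (from_layer n X))) q"
          using i q in_G perm_act_G[OF rep_in[OF p'], of "inv' ?t i"] rep_in[OF p']
          by (simp add: tensor_act_def vec_tensor_def tensor_coords_order1[unfolded One_nat_def] inv_twist[OF \<sigma> p])
        finally show ?thesis using d1 a1 by (simp add: True slice_def)
      qed
    qed
  next
    case False
    have "(map (inv' ?t) is, c) \<in> tensor_coords n (d r) (a r)
        \<longleftrightarrow> (is, c) \<in> tensor_coords n (d r) (a r)" for "is" c
      using map_perm_tensor_coords[OF G_simps(1)[OF t]] .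
    then show ?thesis
      using False r p
      by (auto simp: slice_def stack_action_def hidden_act_def tensor_act_def fun_eq_iff)
  qed
qed

text \<open>The positions \<open>p\<close> and \<open>inv' \<sigma> p\<close> lie in one orbit and
  so carry the same network, which is equivariant under the stabilizer containing the twist.\<close>

lemma affine_slice_act:
  assumes r: "r \<in> {1..H}" and \<sigma>: "\<sigma> \<in> G" and p: "p \<in> {1..n}"
  shows "affine_part (net p) r (slice r p (stack_action n G m l \<tau> H d a r \<sigma> X))
    = tensor_act n (d (r + 1)) (a (r + 1)) (twist n G m l \<tau> \<sigma> p)
        (affine_part (net (inv' \<sigma> p)) r (slice r (inv' \<sigma> p) X))"
proof -
  have p': "inv' \<sigma> p \<in> {1..n}" using act_in[OF G_simps(4)[OF \<sigma>]] p by blast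
  have ind: "ind (inv' \<sigma> p) = ind p" using ind_act[OF G_simps(4)[OF \<sigma>] p] .
  have "slice r (inv' \<sigma> p) X \<in> vecs (coords (net p) r)"
    using slice_vecs[OF r p'] ind by simp
  then show ?thesis
    using invariant[OF ind_in[OF p]] depth[OF ind_in[OF p]] r twist_eq(2)[OF \<sigma> p]
    unfolding slice_act[OF assms] ind invariant_tensor_network_def by simp
qed

text \<open>The action only permutes the entries. This is what removes the twist on the output
  layer.\<close>

lemma sum_tensor_act:
  assumes "g permutes {1..n}"
  shows "(\<Sum>q\<in>tensor_coords n k c. tensor_act n k c g X q) = (\<Sum>q\<in>tensor_coords n k c. X q)"
proof (rule sum.reindex_bij_witness[of _ "\<lambda>(is, c). (map g is, c)" "\<lambda>(is, c). (map (inv' g) is, c)"])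
qed (use map_perm_tensor_coords[OF assms] map_perm_tensor_coords[OF permutes_inv[OF assms]]
    permutes_inv_o[OF assms] in \<open>auto simp: tensor_act_def\<close>)

text \<open>In a hidden layer ReLU acts coordinatewise and so commutes with permutations of
  coordinates. In the last block the summation absorbs the twist and leaves only the permutation of
  positions.\<close>

lemma block_equivariant:
  assumes r: "r \<in> {1..H}" and \<sigma>: "\<sigma> \<in> G"
  shows "block E r (stack_action n G m l \<tau> H d a r \<sigma> X)
    = stack_action n G m l \<tau> H d a (r + 1) \<sigma> (block E r X)"
proof
  fix u
  let ?A = "stack_action n G m l \<tau> H d a"
  have inv: "inv' \<sigma> p \<in> {1..n}" if "p \<in> {1..n}" for p
    using act_in[OF G_simps(4)[OF \<sigma>]] that by blast
  show "block E r (?A r \<sigma> X) u = ?A (r + 1) \<sigma> (block E r X) u"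
  proof (cases "u \<in> coords E (r + 1)")
    case False
    then show ?thesis
      using r by (auto simp: block_def affine_part_def stack_action_def to_layer_def hidden_act_def coords_E)
  next
    case u: True
    show ?thesis
    proof (cases "r = H")
      case True
      then obtain p where p: "u = Inl p" "p \<in> {1..n}" using u by (auto simp: coords_E)
      have *: "block E r Y (Inl q) = (\<Sum>q'\<in>tensor_coords n (d (H + 1)) (a (H + 1)).
          affine_part (net q) H (slice H q Y) q')" if "q \<in> {1..n}" for q Y
        using affine_part_E_output[OF that] coords_net[OF that, of "H + 1"] True
        by (simp add: block_def depth_E)
      have "block E r (?A r \<sigma> X) u = block E r X (Inl (inv' \<sigma> p))"
        using *[OF p(2)] *[OF inv[OF p(2)]] affine_slice_act[OF r \<sigma> p(2)] True
          sum_tensor_act[OF G_simps(1)[OF twist_in[OF \<sigma> p(2)]]] p by simp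
      also have "\<dots> = ?A (r + 1) \<sigma> (block E r X) u"
        using True p inv[OF p(2)] perm_act_G[OF \<sigma>]
        by (simp add: stack_action_def to_layer_def from_layer_def)
      finally show ?thesis .
    next
      case False
      then have r': "r \<in> {1..<H}" using r by auto
      then obtain p "is" c where p: "u = Inr (p, (is, c))" "p \<in> {1..n}"
        "(is, c) \<in> tensor_coords n (d (r + 1)) (a (r + 1))"
        using u by (auto simp: coords_E)
      let ?is = "map (inv' (twist n G m l \<tau> \<sigma> p)) is"
      have q: "(?is, c) \<in> tensor_coords n (d (r + 1)) (a (r + 1))"
        using p(3) map_perm_tensor_coords[OF G_simps(1)[OF G_simps(4)[OF twist_in[OF \<sigma> p(2)]]]] by blast
      have *: "block E r Y (Inr (p, q)) = relu (affine_part (net p) r (slice r p Y) q)"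
        if "p \<in> {1..n}" "q \<in> tensor_coords n (d (r + 1)) (a (r + 1))" for p q Y
        using affine_part_E_hidden[OF r' that] that r'
        by (simp add: block_def depth_E coords_E)
      have "block E r (?A r \<sigma> X) u = block E r X (Inr (inv' \<sigma> p, (?is, c)))"
        using *[OF p(2,3)] *[OF inv[OF p(2)] q] affine_slice_act[OF r \<sigma> p(2)] p
        by (simp add: tensor_act_def)
      also have "\<dots> = ?A (r + 1) \<sigma> (block E r X) u"
        using r' p by (simp add: stack_action_def hidden_act_def tensor_act_def)
      finally show ?thesis .
    qed
  qed
qed

lemma equivariant_stack_network:
  assumes "\<And>r. r \<in> {2..H} \<Longrightarrow> 1 \<le> a r"
  shows "equivariant_network (perm_group n G) E (stack_action n G m l \<tau> H d a)"
  unfolding equivariant_network_def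
proof (intro conjI ballI)
  show "well_formed E"
    unfolding well_formed_def depth_E using H by (auto simp: coords_E)
  show "layer_action (perm_group n G) (coords E r) (stack_action n G m l \<tau> H d a r)"
    if "r \<in> {1..depth E + 1}" for r
  proof (cases "r = 1 \<or> r = H + 1")
    case True
    then have "stack_action n G m l \<tau> H d a r = (\<lambda>\<sigma> X. to_layer n (perm_act {1..n} \<sigma> (from_layer n X)))"
      by (auto simp: stack_action_def fun_eq_iff)
    then show ?thesis using True layer_action_vec by (simp add: coords_E)
  next
    case False
    then have "stack_action n G m l \<tau> H d a r = hidden_act n G m l \<tau> (d r) (a r)"
      by (auto simp: stack_action_def fun_eq_iff)
    moreover have "1 \<le> a r" using assms that False by (auto simp: depth_E)
    ultimately show ?thesis using False layer_action_hidden by (simp add: coords_E)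
  qed
  show "block E r (stack_action n G m l \<tau> H d a r \<sigma> X)
      = stack_action n G m l \<tau> H d a (r + 1) \<sigma> (block E r X)"
    if "r \<in> {1..depth E}" "\<sigma> \<in> carrier (perm_group n G)" for r \<sigma> X
    using block_equivariant that by (simp add: depth_E)
qed

text \<open>Distinct components do not interact, so each runs its own network on the permuted input.
  The range of \<open>r\<close> stops before the last block, whose output is already summed.\<close>

lemma slice_run:
  assumes "r < H" "p \<in> {1..n}"
  shows "slice (r + 1) p (run E r (to_layer n x)) = run (net p) r (vec_tensor n (perm_act {1..n} (rep p) x))"
  using assms(1)
proof (induction r)
  case 0
  \<comment> \<open>Here \<open>x\<close> may take arbitrary values outside \<open>{1..n}\<close>,
    but the permuted vector reads it only inside.\<close>
  have "perm_act {1..n} (rep p) (from_layer n (to_layer n x)) = perm_act {1..n} (rep p) x"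
  proof
    fix i
    show "perm_act {1..n} (rep p) (from_layer n (to_layer n x)) i = perm_act {1..n} (rep p) x i"
    proof (cases "i \<in> {1..n}")
      case True
      then have "inv' (rep p) i \<in> {1..n}" using act_in[OF G_simps(4)[OF rep_in[OF assms(2)]]] by blast
      then show ?thesis
        using True perm_act_G[OF rep_in[OF assms(2)]]
        by (simp add: from_layer_def to_layer_def)
    qed (auto simp: perm_act_def)
  qed
  then show ?case by (simp add: slice_def)
next
  case (Suc r)
  let ?T = "tensor_coords n (d (Suc r + 1)) (a (Suc r + 1))"
  let ?Y = "run E r (to_layer n x)"
  have r: "Suc r \<in> {1..<H}" using Suc.prems by simp
  have "slice (Suc r + 1) p (run E (Suc r) (to_layer n x)) = (\<lambda>q\<in>?T. block E (Suc r) ?Y (Inr (p, q)))"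
    by (simp add: slice_def)
  also have "\<dots> = (\<lambda>q\<in>?T. relu (affine_part (net p) (Suc r) (slice (Suc r) p ?Y) q))"
    using affine_part_E_hidden[OF r assms(2)] r assms(2)
    by (intro restrict_ext) (simp add: block_def depth_E coords_E)
  also have "\<dots> = block (net p) (Suc r) (slice (Suc r) p ?Y)"
    using coords_net[OF assms(2), of "Suc r + 1"] r depth[OF ind_in[OF assms(2)]]
    by (simp add: block_def)
  finally show ?case using Suc by simp
qed

lemma represented_E:
  assumes "p \<in> {1..n}"
  shows "represented E (to_layer n x) (Inl p) = inv_value n (net p) (perm_act {1..n} (rep p) x)"
proof -
  have run_H: "run M H y = block M H (run M (H - 1) y)" for M :: "'i relu_network" and y
    using H by (cases H) simp_all
  have "represented E (to_layer n x) (Inl p) = affine_part E H (run E (H - 1) (to_layer n x)) (Inl p)"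
    by (simp add: represented_def depth_E block_def run_H)
  also have "\<dots> = inv_value n (net p) (perm_act {1..n} (rep p) x)"
    using affine_part_E_output[OF assms] slice_run[of "H - 1", OF _ assms] depth[OF ind_in[OF assms]] H
    by (simp add: run_H inv_value_def represented_def block_def)
  finally show ?thesis .
qed

end

section \<open>Approximation by equivariant networks\<close>

lemma sup_dist_le:
  assumes "\<And>x. x \<in> K \<Longrightarrow> \<bar>f x - g x\<bar> \<le> \<epsilon>"
  shows "sup_dist f g K \<le> ennreal \<epsilon>"
  unfolding sup_dist_def using assms by (intro SUP_least ennreal_leI)

text \<open>The identity puts the orbit start into its own orbit, so the interval is not
  empty.\<close>

lemma (in orbit_setting) orb_start_position:
  assumes "j \<in> {1..m}"
  shows "1 \<le> l j" "orb_start l j \<in> {1..n}"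
proof -
  have "orb_start l j \<in> orbit (perm_group n G) (\<lambda>\<sigma>. \<sigma>) (orb_start l j)"
    unfolding orbit_def using G_simps(2) by (intro CollectI exI[of _ id]) simp
  then show "1 \<le> l j" using orbit_dataD(1)[OF assms] by simp
  then show "orb_start l j \<in> {1..n}" using position_in[of j 1] assms by simp
qed

theorem theorem2p2:
  fixes n m :: nat
    and G :: "(nat \<Rightarrow> nat) set"
    and l :: "nat \<Rightarrow> nat"
    and \<tau> :: "nat \<Rightarrow> nat \<Rightarrow> nat \<Rightarrow> nat"
    and K :: "(nat \<Rightarrow> real) set"
    and F :: "(nat \<Rightarrow> real) \<Rightarrow> nat \<Rightarrow> real"
    and \<epsilon> :: real
  assumes "subgroup G (sym_group n)"
    and "orbit_data n G m l \<tau>"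
    and "compactin (powertop_real {1..n}) K"
    and "\<forall>\<sigma>\<in>G. \<forall>x\<in>K. perm_act {1..n} \<sigma> x \<in> K"
    and "continuous_map (subtopology (powertop_real {1..n}) K) (powertop_real {1..n}) F"
    and "\<forall>\<sigma>\<in>G. \<forall>x\<in>K. F (perm_act {1..n} \<sigma> x) = perm_act {1..n} \<sigma> (F x)"
    and "0 < \<epsilon>"
  shows "\<exists>H d a (N :: nat \<Rightarrow> tensor_coord relu_network).
    (\<forall>j\<in>{1..m}. depth (N j) = H \<and>
       invariant_tensor_network n (Stab n G (orb_start l j)) d a (N j) \<and>
       sup_dist (\<lambda>x. F x (orb_start l j)) (inv_value n (N j)) K < ennreal \<epsilon>) \<and>
    (\<forall>r\<in>{2..H}. 1 \<le> d r) \<and>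
    (let E = stack_network n m l \<tau> H d a N;
         R = (\<lambda>x. from_layer n (represented E (to_layer n x)))
     in (\<forall>x\<in>vecs {1..n}. \<forall>j\<in>{1..m}. \<forall>k\<in>{1..l j}.
           R x (orb_start l j + k - 1) = inv_value n (N j) (perm_act {1..n} (\<tau> j k) x)) \<and>
        equivariant_network (perm_group n G) E (stack_action n G m l \<tau> H d a) \<and>
        (SUP p\<in>{1..n}. sup_dist (\<lambda>x. F x p) (\<lambda>x. R x p) K) < ennreal \<epsilon>)"

proof -
  interpret orbit_setting n m G l \<tau>
    using assms(1,2) by (rule orbit_setting.intro)
  let ?S = "\<lambda>j. Stab n G (orb_start l j)"
  have n: "1 \<le> n" if "j \<in> {1..m}" for j
    using orb_start_position(2)[OF that] by simp
  have cont: "continuous_map (subtopology (powertop_real {1..n}) K) euclideanreal (\<lambda>x. F x (orb_start l j))"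
    if "j \<in> {1..m}" for j
    using assms(5) orb_start_position(2)[OF that] unfolding continuous_map_componentwise by blast
  \<comment> \<open>The bound \<epsilon>/2 leaves room for the strict inequality, since a supremum
    preserves only non-strict bounds.\<close>
  define good where "good j a \<beta> w b \<longleftrightarrow> (\<forall>x\<in>K. \<bar>F x (orb_start l j)
      - (\<Sum>c = 1..a. \<beta> c * relu ((\<Sum>k = 1..n. w c k * x k) + b c))\<bar> \<le> \<epsilon> / 2)" 
    for j and a :: nat and \<beta> w b
  have "\<forall>\<^sub>F a in sequentially. \<exists>\<beta> w b. good j a \<beta> w b" if "j \<in> {1..m}" for j
    unfolding good_def using assms(3,7) cont[OF that] by (intro shallow_relu_approximation) auto
  then have "\<forall>\<^sub>F a in sequentially. \<forall>j\<in>{1..m}. \<exists>\<beta> w b. good j a \<beta> w b"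
    by (intro eventually_ball_finite) auto
  \<comment> \<open>One width serves all orbits, and \<open>1 \<le> a\<close> makes the hidden
    action faithful.\<close>
  from eventually_conj[OF eventually_ge_at_top[of 1] this]
  obtain a where a: "1 \<le> a" "\<forall>j\<in>{1..m}. \<exists>\<beta> w b. good j a \<beta> w b"
    using eventually_happens'[OF sequentially_bot] by blast
  then obtain \<beta> w b where approx: "\<And>j. j \<in> {1..m} \<Longrightarrow> good j a (\<beta> j) (w j) (b j)"
    by metis
  define N where "N j = symmetrized_network n (?S j) a (\<beta> j) (w j) (b j)" for j
  have sym: "symmetrization n (?S j)" if "j \<in> {1..m}" for j
    using n[OF that] subgroup_Stab[OF G] by (rule symmetrization.intro)
  interpret stacked_networks n m G l \<tau> 2 "sym_order n" "sym_channels a" N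
  proof unfold_locales
    show "invariant_tensor_network n (?S j) (sym_order n) (sym_channels a) (N j)" if "j \<in> {1..m}" for j
      unfolding N_def by (rule symmetrization.invariant_symmetrized[OF sym[OF that]])
  qed (simp_all add: N_def symmetrized_network_def sym_order_def sym_channels_def)
  have N_error: "\<bar>F x (orb_start l j) - inv_value n (N j) x\<bar> \<le> \<epsilon> / 2"
    if j: "j \<in> {1..m}" and x: "x \<in> K" for j x
    unfolding N_def
  proof (rule symmetrization.symmetrized_error[OF sym[OF j], where K = K and f = "\<lambda>x. F x (orb_start l j)"])
    fix g x assume g: "g \<in> ?S j" and x: "x \<in> K"
    then have g': "g \<in> G" "g (orb_start l j) = orb_start l j" by (simp_all add: Stab_iff)
    show "perm_act {1..n} g x \<in> K" using assms(4) g' x by blast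
    \<comment> \<open>Hence equivariance of \<open>F\<close>, read at this coordinate, is invariance
      under the stabilizer.\<close>
    have "inv' g (orb_start l j) = orb_start l j"
      using inv_act(1)[OF g'(1), of "orb_start l j"] g'(2) by simp
    then show "F (perm_act {1..n} g x) (orb_start l j) = F x (orb_start l j)"
      using assms(6) g' x perm_act_apply[OF G_simps(1)[OF g'(1)] orb_start_position(2)[OF j]] by simp
  qed (use approx[OF j, unfolded good_def] x in auto)
  define R where "R x = from_layer n (represented E (to_layer n x))" for x
  have R: "R x p = inv_value n (net p) (perm_act {1..n} (rep p) x)" if "p \<in> {1..n}" for x p
    using represented_E[OF that] that by (simp add: R_def from_layer_def)
  have R_error: "\<bar>F x p - R x p\<bar> \<le> \<epsilon> / 2" if p: "p \<in> {1..n}" and x: "x \<in> K" for p x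
  proof -
    let ?y = "perm_act {1..n} (rep p) x"
    have "?y \<in> K" using assms(4) rep_in[OF p] x by blast
    \<comment> \<open>Equivariance under \<open>rep p\<close>, read at the orbit start, which
      \<open>inv' (rep p)\<close> sends to \<open>p\<close>.\<close>
    moreover have "F ?y (orb_start l (ind p)) = F x p"
      using assms(6) rep_in[OF p] x inv_rep[OF p]
        perm_act_apply[OF G_simps(1)[OF rep_in[OF p]] orb_start_position(2)[OF ind_in[OF p]]] by simp
    ultimately show ?thesis
      using N_error[OF ind_in[OF p]] R[OF p] by metis
  qed
  have \<epsilon>: "ennreal (\<epsilon> / 2) < ennreal \<epsilon>" using assms(7) by (intro ennreal_lessI) auto
  show ?thesis
  proof (rule exI[of _ 2], rule exI[of _ "sym_order n"], rule exI[of _ "sym_channels a"], rule exI[of _ N],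
      unfold Let_def, fold R_def, intro conjI ballI)
    show "depth (N j) = 2" "invariant_tensor_network n (?S j) (sym_order n) (sym_channels a) (N j)"
      if "j \<in> {1..m}" for j
      using depth invariant that by blast+
    show "sup_dist (\<lambda>x. F x (orb_start l j)) (inv_value n (N j)) K < ennreal \<epsilon>" if "j \<in> {1..m}" for j
      using sup_dist_le[OF N_error[OF that]] \<epsilon> by (rule le_less_trans)
    show "1 \<le> sym_order n r" if "r \<in> {2..2}" for r
      using that by (simp add: sym_order_def)
    show "R x (orb_start l j + k - 1) = inv_value n (N j) (perm_act {1..n} (\<tau> j k) x)"
      if "j \<in> {1..m}" "k \<in> {1..l j}" for x j k
      using R[OF position_in[OF that]] position[OF that] by (simp only:)
    show "equivariant_network (perm_group n G) E (stack_action n G m l \<tau> 2 (sym_order n) (sym_channels a))"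
      using a(1) by (intro equivariant_stack_network) (simp add: sym_channels_def)
    have "(SUP p\<in>{1..n}. sup_dist (\<lambda>x. F x p) (\<lambda>x. R x p) K) \<le> ennreal (\<epsilon> / 2)"
      by (intro SUP_least sup_dist_le R_error)
    then show "(SUP p\<in>{1..n}. sup_dist (\<lambda>x. F x p) (\<lambda>x. R x p) K) < ennreal \<epsilon>"
      using \<epsilon> by (rule le_less_trans)
  qed
qed

end
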